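(* Let $X=(X_t)_{t\ge 0}$ be a Markov process with values in $\mathbb{R}^d$ satisfying the following condition X: the process $X$ possesses a transition probability density $p_t(x,y)$ that is differentiable with respect to $t$ and satisfies $$|\partial_t p_t(x,y)|\le C_T\, t^{-1} q_{t,x}(y),\qquad t\le T,\quad C_T\ge 1,$$ for some measurable function $q$ such that for any fixed $t$ and $x$ the function $q_{t,x}$ is a distribution density. Let $g$ be any analytic function defined in a neighborhood of $0$, and let $D_g,R_g>0$ be constants such that $$\left|\frac{g^{(m)}(0)}{m!}\right|\le D_g\left(\frac{1}{R_g}\right)^m\quad\text{for any natural } m.$$ Then for any bounded function $f$ and any measurable bounded function $h$ such that $T\|h\|<R_g$, $$\Big|E_x\big[g(I_T(h))f(X_T)\big]-E_x\big[g(I_{T,n}(h))f(X_T)\big]\Big|\le C_{T,h,D_g,R_g}\left(\frac{\log n}{n}\right)\|f\|,$$ where $$C_{T,h,D_g,R_g}=6D_gC_T\,\frac{T\|h\|}{R_g}\left(1+\frac{T\|h\|}{R_g}\right)\frac{1}{\left(1-\frac{T\|h\|}{R_g}\right)^3}.$$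
   Context: $E_x$ denotes expectation with respect to the law $P_x$ of the Markov process $X$ conditioned by $X_0=x$. The integral functional and its integral sums are $$I_T(h)=\int_0^T h(X_t)\,dt,\qquad I_{T,n}(h)=\frac{T}{n}\sum_{j=0}^{n-1}h(X_{jT/n}),\quad n\ge 1.$$ $\|\cdot\|$ denotes the sup-norm.
   Formalization: The bound is stated for n ≥ 2: at n = 1 its right-hand side is 0 since log 1 = 0, and it fails, e.g. for Brownian motion from 0 with g(y)=y, f=1 and h the indicator of [0,∞). *)

theory Defs
  imports "HOL-Probability.Probability"
begin

definition sup_norm :: "('a \<Rightarrow> real) \<Rightarrow> real" where
  "sup_norm h = (SUP x. \<bar>h x\<bar>)"

definition real_analytic_on :: "(real \<Rightarrow> real) \<Rightarrow> real set \<Rightarrow> bool" where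
  "real_analytic_on g U \<longleftrightarrow> (\<forall>x\<in>U. \<exists>F. (\<lambda>z. g (x + z)) has_fps_expansion F)"

definition natural_filtration :: "'w measure \<Rightarrow> (real \<Rightarrow> 'w \<Rightarrow> 'e::topological_space) \<Rightarrow> real \<Rightarrow> 'w measure"
  where "natural_filtration M X s =
    sigma (space M) {X u -` A \<inter> space M | u A. 0 \<le> u \<and> u \<le> s \<and> A \<in> sets borel}"

(* A time-homogeneous Markov process given as a family of laws P x on one measurable space;
   only the space and the sigma-algebra of M are used. Only the values X t with t >= 0 matter.
   Joint measurability makes the time integrals of h (X t) random variables. *)
locale markov_process =
  fixes M :: "'w measure"
    and X :: "real \<Rightarrow> 'w \<Rightarrow> 'e::topological_space"
    and P :: "'e \<Rightarrow> 'w measure"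
  assumes prob_law: "prob_space (P x)"
    and sets_law: "sets (P x) = sets M"
    and measurable_process:
      "(\<lambda>(t, \<omega>). X t \<omega>) \<in> measurable (restrict_space borel {0..} \<Otimes>\<^sub>M M) borel"
    and initial_value: "AE \<omega> in P x. X 0 \<omega> = x"
    and measurable_transition:
      "\<lbrakk>0 \<le> t; A \<in> sets borel\<rbrakk> \<Longrightarrow>
        (\<lambda>x. measure (P x) (X t -` A \<inter> space M)) \<in> borel_measurable borel"
    and markov_property:
      "\<lbrakk>0 \<le> s; 0 \<le> t; A \<in> sets borel\<rbrakk> \<Longrightarrow>
        AE \<omega> in P x.
          real_cond_exp (P x) (natural_filtration M X s) (\<lambda>\<omega>'. indicator A (X (s + t) \<omega>')) \<omega>
            = measure (P (X s \<omega>)) (X t -` A \<inter> space M)"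

(* Nonnegativity is stated separately because ennreal truncates negative values to 0. *)
definition transition_density ::
  "(real \<Rightarrow> 'w \<Rightarrow> 'e::euclidean_space) \<Rightarrow> ('e \<Rightarrow> 'w measure) \<Rightarrow> (real \<Rightarrow> 'e \<Rightarrow> 'e \<Rightarrow> real) \<Rightarrow> bool"
  where "transition_density X P p \<longleftrightarrow>
    (\<forall>t>0. \<forall>x. (\<forall>y. 0 \<le> p t x y) \<and> distributed (P x) lborel (X t) (\<lambda>y. ennreal (p t x y)))"

definition condition_X ::
  "(real \<Rightarrow> 'w \<Rightarrow> 'e::euclidean_space) \<Rightarrow> ('e \<Rightarrow> 'w measure) \<Rightarrow> real \<Rightarrow> real \<Rightarrow> bool"
  where "condition_X X P T C \<longleftrightarrow> 1 \<le> C \<and>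
    (\<exists>p q. transition_density X P p \<and>
      (\<forall>t>0. \<forall>x y. (\<lambda>s. p s x y) differentiable (at t)) \<and>
      (\<lambda>(t, x, y). q t x y) \<in> borel_measurable (restrict_space borel ({0<..T} \<times> UNIV \<times> UNIV)) \<and>
      (\<forall>t\<in>{0<..T}. \<forall>x. (\<forall>y. 0 \<le> q t x y) \<and>
        prob_space (density lborel (\<lambda>y. ennreal (q t x y)))) \<and>
      (\<forall>t\<in>{0<..T}. \<forall>x y. \<bar>deriv (\<lambda>s. p s x y) t\<bar> \<le> C * inverse t * q t x y))"

definition integral_functional ::
  "(real \<Rightarrow> 'w \<Rightarrow> 'e) \<Rightarrow> real \<Rightarrow> ('e \<Rightarrow> real) \<Rightarrow> 'w \<Rightarrow> real"
  where "integral_functional X T h \<omega> = (LINT t:{0..T}|lborel. h (X t \<omega>))"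

definition integral_sum ::
  "(real \<Rightarrow> 'w \<Rightarrow> 'e) \<Rightarrow> real \<Rightarrow> nat \<Rightarrow> ('e \<Rightarrow> real) \<Rightarrow> 'w \<Rightarrow> real"
  where "integral_sum X T n h \<omega> = T / real n * (\<Sum>j<n. h (X (real j * T / real n) \<omega>))"

end

theory Submission
  imports Defs "HOL-Complex_Analysis.Complex_Analysis" "HOL-Real_Asymp.Real_Asymp"
begin

text \<open>
  Expanding \<open>g\<close> into its power series reduces the claim to a bound of order \<open>k\<^sup>2 log n / n\<close> for the
  difference of the \<open>k\<close>-th moments of \<open>I\<^sub>T(h)\<close> and \<open>I\<^sub>T\<^sub>,\<^sub>n(h)\<close>. Telescoping and Fubini leave expectations
  of \<open>h (X t\<^sub>1) \<dots> h (X t\<^sub>k\<^sub>-\<^sub>1) (h (X s) - h (X (m \<delta>))) f (X T)\<close> with fixed times \<open>t\<^sub>i\<close>, where \<open>\<delta> = T/n\<close> and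
  \<open>m \<delta> \<le> s < (m + 1) \<delta>\<close>. Condition X says that \<open>t \<mapsto> P\<^sub>t\<close> moves by at most \<open>C log (t/s)\<close> in total
  variation between \<open>s\<close> and \<open>t\<close>, so by the Markov property only the nearest \<open>t\<^sub>i\<close> (or \<open>0\<close>, \<open>T\<close>) on either side of \<open>s\<close>
  matters, with a logarithmic error; if some \<open>t\<^sub>i\<close> lies in the cell of \<open>s\<close> or the one before, the trivial bound
  is used. Bounding the nearest times by the sum over all of them avoids ordering the \<open>t\<^sub>i\<close>; the
  integral over \<open>s\<close> then costs \<open>O(\<delta> log n)\<close> for each of the \<open>k - 1\<close> times and for the pair \<open>0\<close>, \<open>T\<close>, and
  the \<open>k\<close> telescoping terms give the factor \<open>k\<^sup>2\<close>.
\<close>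

section \<open>Power series of real analytic functions\<close>

text \<open>The Markov property is used at grid points rather than at the times
  \<open>t\<^sub>i\<close> themselves, so that the bound depends only on the cell of each
  \<open>t\<^sub>i\<close> and can be summed over the cells of \<open>s\<close>. This moves an
  earlier time up to the end of its cell. From the cell just before \<open>s\<close> it would land
  on \<open>m \<delta>\<close>, where the logarithm is infinite for every \<open>s\<close>; hence
  the trivial bound there. A later time moves down to the start of its cell. From the next cell it
  lands on \<open>(m + 1) \<delta>\<close>, and the singularity appears only as \<open>s\<close>
  tends to that point: it is integrable, with mean \<open>1\<close>. So the estimate must be
  averaged over the cell. The constant 6 comes from the sums of these means: the logarithmic ones
  add up to at most \<open>1 + ln n\<close>, the trivial ones to at most \<open>4\<close>, and
  \<open>5 + ln n\<close> is at most \<open>6 * ln n\<close> from \<open>n = 3\<close> on. A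
  separate obstacle is \<open>g\<close>: the coefficient bound controls its Taylor series at
  \<open>0\<close>, while away from \<open>0\<close> the function is only known to be analytic. An
  identity theorem on the closed interval of possible values makes the two agree.\<close>

lemma has_fps_expansion_eventually_sums:
  fixes f :: "'a::{banach, real_normed_div_algebra} \<Rightarrow> 'a"
  assumes "f has_fps_expansion F"
  shows "eventually (\<lambda>z. (\<lambda>n. fps_nth F n * z ^ n) sums f z) (nhds 0)"
proof -
  have "eventually (\<lambda>z. z \<in> eball 0 (fps_conv_radius F)) (nhds 0)"
    using assms by (intro eventually_nhds_in_open) (auto simp: has_fps_expansion_def zero_ereal_def)
  moreover have "eventually (\<lambda>z. eval_fps F z = f z) (nhds 0)"
    using assms by (simp add: has_fps_expansion_def)
  ultimately show ?thesis
  proof eventually_elim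
    case (elim z)
    then show ?case using sums_eval_fps[of z F] by (simp add: in_eball_iff)
  qed
qed

text \<open>The local dichotomy behind the identity theorem: a nonzero coefficient prevents zeros
  from accumulating at the centre.\<close>

lemma has_fps_expansion_isolated_zero:
  fixes f :: "'a::{banach, real_normed_field} \<Rightarrow> 'a"
  assumes "f has_fps_expansion F"
  shows "eventually (\<lambda>z. f z = 0) (nhds 0) \<or> eventually (\<lambda>z. f z \<noteq> 0) (at 0)"
proof (cases "F = 0")
  case True
  with assms show ?thesis by (simp add: has_fps_expansion_def)
next
  case False
  then obtain m where m: "fps_nth F m \<noteq> 0" by (auto simp: fps_eq_iff)
  \<comment> \<open>Multiplying by \<open>z\<close> makes the function vanish at \<open>0\<close>, as \<open>powser_0_nonzero\<close> requires.\<close>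
  have "(\<lambda>z. z * f z) has_fps_expansion fps_X * F"
    by (intro fps_expansion_intros assms)
  from has_fps_expansion_eventually_sums[OF this] obtain r where r: "0 < r"
    "\<And>z. dist z 0 < r \<Longrightarrow> (\<lambda>n. fps_nth (fps_X * F) n * z ^ n) sums (z * f z)"
    by (auto simp: eventually_nhds_metric)
  obtain s where s: "0 < s" "\<And>z. z \<in> cball 0 s - {0} \<Longrightarrow> z * f z \<noteq> 0"
  proof (rule powser_0_nonzero[of r 0 "fps_nth (fps_X * F)" "\<lambda>z. z * f z" "Suc m"])
    show "fps_nth (fps_X * F) (Suc m) \<noteq> 0" using m by simp
  qed (use r in auto)
  then have "eventually (\<lambda>z. f z \<noteq> 0) (at 0)"
    unfolding eventually_at by (intro exI[of _ s]) auto
  then show ?thesis ..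
qed

text \<open>Identity theorem on a connected set that need not be open. Vanishing identically around
  a point is a locally constant property on \<open>S\<close>: it holds at all points near
  \<open>a\<close> if \<open>d\<close> vanishes around \<open>a\<close>, and at none of them if
  \<open>a\<close> is at most an isolated zero.\<close>

lemma locally_zero_on_connected:
  fixes d :: "real \<Rightarrow> real"
  assumes S: "connected S" and x: "x \<in> S" and y: "y \<in> S"
    and exp: "\<And>z. z \<in> S \<Longrightarrow> \<exists>F. (\<lambda>w. d (z + w)) has_fps_expansion F"
    and zero: "eventually (\<lambda>z. d z = 0) (nhds x)"
  shows "d y = 0"
proof -
  have "eventually (\<lambda>z. d z = 0) (nhds y)"
  proof (rule connected_induction_simple[OF S x y, where P="\<lambda>a. eventually (\<lambda>z. d z = 0) (nhds a)"])
    show "eventually (\<lambda>z. d z = 0) (nhds x)" by (rule zero)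
    fix a assume "a \<in> S"
    from exp[OF this] obtain F where "(\<lambda>w. d (a + w)) has_fps_expansion F" by blast
    from has_fps_expansion_isolated_zero[OF this]
    show "\<exists>V. openin (top_of_set S) V \<and> a \<in> V \<and>
      (\<forall>b\<in>V. \<forall>c\<in>V. eventually (\<lambda>z. d z = 0) (nhds b) \<longrightarrow> eventually (\<lambda>z. d z = 0) (nhds c))"
    proof
      assume "eventually (\<lambda>w. d (a + w) = 0) (nhds 0)"
      then have "eventually (\<lambda>z. d z = 0) (nhds a)"
        by (subst nhds_to_0) (simp add: eventually_filtermap add.commute)
      then obtain V where "open V" "a \<in> V" "\<And>z. z \<in> V \<Longrightarrow> d z = 0"
        by (auto simp: eventually_nhds)
      then show ?thesis using \<open>a \<in> S\<close>
        by (intro exI[of _ "S \<inter> V"]) (auto simp: eventually_nhds openin_open)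
    next
      assume "eventually (\<lambda>w. d (a + w) \<noteq> 0) (at 0)"
      then have "eventually (\<lambda>z. d z \<noteq> 0) (at a)"
        by (subst at_to_0) (simp add: eventually_filtermap add.commute)
      then obtain V where V: "open V" "a \<in> V" "\<And>z. z \<in> V \<Longrightarrow> z \<noteq> a \<Longrightarrow> d z \<noteq> 0"
        by (auto simp: eventually_at_topological)
      \<comment> \<open>If \<open>d\<close> vanished around \<open>b\<close>, then \<open>a\<close>
        would be the only point near \<open>b\<close>, an isolated point of the real line.\<close>
      have "\<not> eventually (\<lambda>z. d z = 0) (nhds b)" if "b \<in> V" for b
      proof
        assume "eventually (\<lambda>z. d z = 0) (nhds b)"
        moreover have "eventually (\<lambda>z. z \<in> V) (nhds b)" using V(1) that by (intro eventually_nhds_in_open)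
        ultimately have "eventually (\<lambda>z. z = a) (nhds b)"
          by eventually_elim (use V(3) in blast)
        then have "eventually (\<lambda>z. z = a \<and> z \<noteq> b) (at b)"
          by (auto simp: eventually_at_filter elim: eventually_mono)
        moreover from \<open>eventually (\<lambda>z. z = a) (nhds b)\<close> have "b = a"
          by (rule eventually_nhds_x_imp_x)
        ultimately show False by simp
      qed
      then show ?thesis using V(1,2) \<open>a \<in> S\<close>
        by (intro exI[of _ "S \<inter> V"]) (auto simp: openin_open)
    qed
  qed
  then show ?thesis by (rule eventually_nhds_x_imp_x)
qed

text \<open>Serves both the real series and its complexification. The bound may start at
  \<open>m = 1\<close> because a single coefficient does not affect the radius.\<close>

lemma fps_conv_radius_ge_geometric:
  fixes a :: "nat \<Rightarrow> 'a::{banach, real_normed_div_algebra}"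
  assumes "\<And>m. 1 \<le> m \<Longrightarrow> norm (a m) \<le> D * (1 / R) ^ m" "0 < R"
  shows "ereal R \<le> fps_conv_radius (Abs_fps a)"
  unfolding fps_conv_radius_def
proof (rule conv_radius_geI_ex')
  fix r assume r: "0 < r" "ereal r < ereal R"
  show "summable (\<lambda>n. fps_nth (Abs_fps a) n * of_real r ^ n)"
  proof (rule summable_comparison_test'[of "\<lambda>n. D * (r / R) ^ n" 1])
    show "summable (\<lambda>n. D * (r / R) ^ n)"
      using r assms(2) by (intro summable_mult summable_geometric) simp
    show "norm (fps_nth (Abs_fps a) n * of_real r ^ n) \<le> D * (r / R) ^ n" if "1 \<le> n" for n
      using mult_right_mono[OF assms(1)[OF that], of "r ^ n"] r
      by (simp add: norm_mult norm_power power_divide)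
  qed
qed

text \<open>Recentring goes through the complex plane: the complexified sum is holomorphic on the
  disc and therefore has an expansion at \<open>x\<close>, and the real parts of its coefficients
  represent the original function on the real line.\<close>

lemma eval_fps_real_has_fps_expansion_at:
  fixes a :: "nat \<Rightarrow> real"
  assumes coeff: "\<And>m. 1 \<le> m \<Longrightarrow> \<bar>a m\<bar> \<le> D * (1 / R) ^ m" and R: "0 < R" and x: "\<bar>x\<bar> < R"
  shows "\<exists>E. (\<lambda>w. eval_fps (Abs_fps a) (x + w)) has_fps_expansion E"
proof -
  let ?G = "eval_fps (Abs_fps (\<lambda>m. complex_of_real (a m)))"
  have rad: "ereal R \<le> fps_conv_radius (Abs_fps a)"
    by (rule fps_conv_radius_ge_geometric) (use coeff R in auto)
  have crad: "ereal R \<le> fps_conv_radius (Abs_fps (\<lambda>m. complex_of_real (a m)))"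
    by (rule fps_conv_radius_ge_geometric) (use coeff R in auto)
  have G: "?G (of_real y) = of_real (eval_fps (Abs_fps a) y)" if "\<bar>y\<bar> < R" for y
  proof -
    have "ereal \<bar>y\<bar> < ereal R" using that by simp
    then have "norm (complex_of_real y) < fps_conv_radius (Abs_fps (\<lambda>m. complex_of_real (a m)))"
      "norm y < fps_conv_radius (Abs_fps a)"
      using less_le_trans[OF \<open>ereal \<bar>y\<bar> < ereal R\<close> crad] less_le_trans[OF \<open>ereal \<bar>y\<bar> < ereal R\<close> rad]
      by simp_all
    from sums_eval_fps[OF this(1)] sums_of_real[OF sums_eval_fps[OF this(2)], where ?'a=complex]
    show ?thesis by (simp add: sums_iff)
  qed
  have "ball 0 R \<subseteq> eball 0 (fps_conv_radius (Abs_fps (\<lambda>m. complex_of_real (a m))))"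
    by (auto simp: in_eball_iff intro!: less_le_trans[OF _ crad])
  then have "?G holomorphic_on ball 0 R" by (rule holomorphic_on_eval_fps)
  then have "?G analytic_on {of_real x}"
    using x by (auto simp: analytic_at intro!: exI[of _ "ball 0 R"])
  from analytic_at_imp_has_fps_expansion[OF this]
  obtain E where E: "(\<lambda>w. ?G (of_real x + w)) has_fps_expansion E" ..
  have lim: "filterlim complex_of_real (nhds 0) (nhds 0)"
    using tendsto_of_real[OF filterlim_ident, of "0::real"] by simp
  from eventually_compose_filterlim[OF has_fps_expansion_eventually_sums[OF E] lim]
  have "eventually (\<lambda>w. (\<lambda>n. fps_nth E n * of_real w ^ n) sums ?G (of_real x + of_real w)) (nhds (0::real))" .
  moreover have "eventually (\<lambda>w. w \<in> ball 0 (R - \<bar>x\<bar>)) (nhds (0::real))"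
    using x by (intro eventually_nhds_in_open) auto
  ultimately have "eventually (\<lambda>w. (\<lambda>n. fps_nth (Abs_fps (\<lambda>n. Re (fps_nth E n))) n * w ^ n)
      sums eval_fps (Abs_fps a) (x + w)) (nhds 0)"
  proof eventually_elim
    case (elim w)
    then have "\<bar>x + w\<bar> < R" by auto
    from G[OF this] sums_Re[OF elim(1)] show ?case
      by (simp del: of_real_power add: of_real_power[symmetric])
  qed
  from has_fps_expansionI[OF this] show ?thesis by (rule exI)
qed

lemma higher_deriv_has_fps_expansion:
  fixes f :: "'a::{banach, real_normed_field} \<Rightarrow> 'a"
  assumes "f has_fps_expansion F"
  shows "(deriv ^^ m) f has_fps_expansion (fps_deriv ^^ m) F"
  using assms by (induction m) (auto intro: has_fps_expansion_deriv)

lemma fps_nth_0_higher_deriv: "fps_nth ((fps_deriv ^^ m) F) 0 = fact m * (fps_nth F m :: real)"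
proof (induction m arbitrary: F)
  case (Suc m)
  have "fps_nth ((fps_deriv ^^ Suc m) F) 0 = fps_nth ((fps_deriv ^^ m) (fps_deriv F)) 0"
    by (simp only: funpow_Suc_right comp_def)
  then show ?case by (simp add: Suc algebra_simps)
qed simp

text \<open>Analyticity at \<open>0\<close> identifies \<open>g\<close> with its Taylor series only
  near \<open>0\<close>. Both are analytic along \<open>{-S..S}\<close>, so the identity theorem
  carries the equality to the whole interval.\<close>

lemma real_analytic_power_series:
  fixes g :: "real \<Rightarrow> real"
  assumes g: "real_analytic_on g U" "{-S..S} \<subseteq> U" and S: "0 \<le> S" "S < R"
    and coeff: "\<And>m. 1 \<le> m \<Longrightarrow> \<bar>(deriv ^^ m) g 0 / fact m\<bar> \<le> D * (1 / R) ^ m"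
    and y: "\<bar>y\<bar> \<le> S"
  shows "(\<lambda>m. (deriv ^^ m) g 0 / fact m * y ^ m) sums g y"
proof -
  define a where "a m = (deriv ^^ m) g 0 / fact m" for m
  have coeff_a: "\<And>m. 1 \<le> m \<Longrightarrow> \<bar>a m\<bar> \<le> D * (1 / R) ^ m" using coeff by (simp add: a_def)
  let ?G = "eval_fps (Abs_fps a)"
  have R: "0 < R" using S by linarith
  have exp: "\<exists>F. (\<lambda>w. g (z + w)) has_fps_expansion F" if "z \<in> {-S..S}" for z
    using g that by (auto simp: real_analytic_on_def)
  obtain F where F: "g has_fps_expansion F" using exp[of 0] S by auto
  have "F = Abs_fps a"
  proof (rule fps_ext)
    fix m
    have "(deriv ^^ m) g 0 = fact m * fps_nth F m"
      using has_fps_expansion_imp_0_eq_fps_nth_0[OF higher_deriv_has_fps_expansion[OF F]]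
      by (simp add: fps_nth_0_higher_deriv)
    then show "fps_nth F m = fps_nth (Abs_fps a) m" by (simp add: a_def)
  qed
  with F have "eventually (\<lambda>z. ?G z = g z) (nhds 0)" by (simp add: has_fps_expansion_def)
  then have zero: "eventually (\<lambda>z. g z - ?G z = 0) (nhds 0)" by (auto elim: eventually_mono)
  have "g y - ?G y = 0"
  proof (rule locally_zero_on_connected[where S="{-S..S}" and x=0 and d="\<lambda>z. g z - ?G z"])
    fix z assume z: "z \<in> {-S..S}"
    then have "\<bar>z\<bar> < R" using S by auto
    from exp[OF z] eval_fps_real_has_fps_expansion_at[OF coeff_a R this]
    obtain F E where "(\<lambda>w. g (z + w)) has_fps_expansion F" "(\<lambda>w. ?G (z + w)) has_fps_expansion E" by blast
    then show "\<exists>F. (\<lambda>w. g (z + w) - ?G (z + w)) has_fps_expansion F"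
      by (intro exI[of _ "F - E"] has_fps_expansion_diff)
  qed (use zero S y in auto)
  moreover have "ereal R \<le> fps_conv_radius (Abs_fps a)"
    by (rule fps_conv_radius_ge_geometric) (use coeff_a R in auto)
  then have "norm y < fps_conv_radius (Abs_fps a)"
    using y S by (auto intro: less_le_trans[of _ "ereal R"])
  from sums_eval_fps[OF this] have "(\<lambda>m. a m * y ^ m) sums ?G y" by simp
  ultimately show ?thesis by (simp add: a_def)
qed

text \<open>Source of the factor \<open>z * (1 + z) / (1 - z) ^ 3\<close> in the final constant, as
  the \<open>m\<close>-th moment costs a factor \<open>m ^ 2\<close>. The decomposition
  \<open>m ^ 2 = (m + 1) * (m + 2) - 3 * (m + 1) + 1\<close> reduces the sum to the geometric series
  and its first two derivatives.\<close>

lemma sums_square_times_power: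
  fixes z :: real
  assumes "\<bar>z\<bar> < 1"
  shows "(\<lambda>m. (real m)\<^sup>2 * z ^ m) sums (z * (1 + z) / (1 - z) ^ 3)"
proof -
  have nz: "norm z < 1" using assms by simp
  have s2: "(\<lambda>n. (real n + 1) * (real n + 2) * z ^ n) sums (2 / (1 - z) ^ 3)"
  proof -
    have "(\<lambda>n. diffs (\<lambda>n. real (Suc n)) n * z ^ n) sums (2 / (1 - z) ^ 3)"
    proof (rule termdiffs_sums_strong[of 1 _ "\<lambda>z. 1 / (1 - z)\<^sup>2"])
      show "(\<lambda>n. real (Suc n) * w ^ n) sums (1 / (1 - w)\<^sup>2)" if "norm w < 1" for w
        using geometric_deriv_sums[OF that] by simp
      show "((\<lambda>z. 1 / (1 - z)\<^sup>2) has_field_derivative 2 / (1 - z) ^ 3) (at z)"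
      proof -
        have "1 - z \<noteq> 0" using assms by auto
        then show ?thesis
          by (auto intro!: derivative_eq_intros simp: divide_simps) (simp add: eval_nat_numeral)
      qed
    qed (use nz in auto)
    then show ?thesis by (simp add: diffs_def algebra_simps)
  qed
  have "(\<lambda>n. (real n + 1) * (real n + 2) * z ^ n - 3 * (real (Suc n) * z ^ n) + z ^ n)
      sums (2 / (1 - z) ^ 3 - 3 * (1 / (1 - z)\<^sup>2) + 1 / (1 - z))"
    using geometric_deriv_sums[OF nz]
    by (intro sums_add sums_diff sums_mult s2 geometric_sums nz) simp
  moreover have "(real n + 1) * (real n + 2) * z ^ n - 3 * (real (Suc n) * z ^ n) + z ^ n = (real n)\<^sup>2 * z ^ n" for n
    by (simp add: power2_eq_square algebra_simps)
  moreover have "2 / (1 - z) ^ 3 - 3 * (1 / (1 - z)\<^sup>2) + 1 / (1 - z) = z * (1 + z) / (1 - z) ^ 3"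
  proof -
    define c where "c = 1 - z"
    have c: "c \<noteq> 0" "z = 1 - c" using assms by (auto simp: c_def)
    show ?thesis unfolding c(2) using c(1)
      by (simp add: field_simps power2_eq_square power3_eq_cube)
  qed
  ultimately show ?thesis by simp
qed

section \<open>Logarithmic weights on a grid\<close>

text \<open>
  Let \<open>s = m \<delta> + u\<close> lie in the \<open>m\<close>-th cell and \<open>t\<close> in the \<open>c\<close>-th cell, \<open>d = c - m\<close>. Then \<open>cell_weight \<delta> d u\<close>
  is the price of replacing \<open>s\<close> by \<open>m \<delta>\<close> next to \<open>t\<close>: it is \<open>ln ((s - r) / (m \<delta> - r))\<close> for \<open>r = (c + 1) \<delta>\<close>
  if \<open>t\<close> is earlier, \<open>ln ((r - m \<delta>) / (r - s))\<close> for \<open>r = c \<delta>\<close> if \<open>t\<close> is later, and the trivial bound \<open>2\<close> if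
  \<open>t\<close> may be too close to \<open>m \<delta>\<close>. The times \<open>0\<close> and \<open>T = n \<delta>\<close> enter with \<open>c = -1\<close> and \<open>c = n\<close>.
\<close>

definition cell_weight :: "real \<Rightarrow> int \<Rightarrow> real \<Rightarrow> real" where
  "cell_weight \<delta> d u =
    (if d = 0 \<or> d = -1 then 2
     else if 1 \<le> d then ln (of_int d * \<delta> / (of_int d * \<delta> - u))
     else ln ((u + of_int (- d - 1) * \<delta>) / (of_int (- d - 1) * \<delta>)))"

text \<open>For \<open>j \<ge> 1\<close> this is the average of \<open>ln ((u + j) / j)\<close> over
  \<open>0 < u < 1\<close>, and \<open>right_mean w\<close> below is that of
  \<open>ln (w / (w - u))\<close> for \<open>w \<ge> 1\<close>. The weights are invariant under
  scaling, so the averages do not involve \<open>\<delta>\<close>. At \<open>w = 1\<close> the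
  vanishing factor \<open>w - 1\<close> leaves the correct value \<open>1\<close>.\<close>

definition left_mean :: "nat \<Rightarrow> real" where
  "left_mean j = (real j + 1) * (ln (real j + 1) - ln (real j)) - 1"

definition right_mean :: "nat \<Rightarrow> real" where
  "right_mean w = 1 - (real w - 1) * (ln (real w) - ln (real w - 1))"

definition cell_mean :: "int \<Rightarrow> real" where
  "cell_mean d =
    (if d = 0 \<or> d = -1 then 2 else if 1 \<le> d then right_mean (nat d) else left_mean (nat (- d - 1)))"

lemma cell_weight_nonneg:
  assumes "0 < u" "u < \<delta>"
  shows "0 \<le> cell_weight \<delta> d u"
proof -
  have *: "u < of_int d * \<delta>" if "1 \<le> d" for d :: int
  proof -
    have "1 * \<delta> \<le> of_int d * \<delta>"
      using that assms by (intro mult_right_mono) simp_all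
    then show ?thesis using assms by linarith
  qed
  have right: "0 \<le> ln (of_int d * \<delta> / (of_int d * \<delta> - u))" if "1 \<le> d" for d
    using *[OF that] assms by (intro ln_ge_zero) (simp add: field_simps)
  have left: "0 \<le> ln ((u + of_int d * \<delta>) / (of_int d * \<delta>))" if "1 \<le> d" for d
    using *[OF that] assms by (intro ln_ge_zero) (simp add: field_simps)
  show ?thesis
    using left[of "- d - 1"] right[of d] unfolding cell_weight_def by auto
qed

text \<open>One-sided limits replace endpoint values because the weight for \<open>d = 1\<close> has
  a logarithmic singularity at \<open>u = \<delta>\<close>; nonnegativity then yields integrability
  along with the value.\<close>

lemma interval_FTC_nonneg_real:
  fixes f F :: "real \<Rightarrow> real"
  assumes "a < b"
    and F: "\<And>x. a < x \<Longrightarrow> x < b \<Longrightarrow> (F has_real_derivative f x) (at x)"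
    and f: "\<And>x. a < x \<Longrightarrow> x < b \<Longrightarrow> isCont f x"
    and nonneg: "\<And>x. a < x \<Longrightarrow> x < b \<Longrightarrow> 0 \<le> f x"
    and A: "(F \<longlongrightarrow> A) (at_right a)" and B: "(F \<longlongrightarrow> B) (at_left b)"
  shows "set_integrable lborel {a<..<b} f" "(LINT x:{a<..<b}|lborel. f x) = B - A"
proof -
  have "((F \<circ> real_of_ereal) \<longlongrightarrow> A) (at_right (ereal a))" "((F \<circ> real_of_ereal) \<longlongrightarrow> B) (at_left (ereal b))"
    using A B by (simp_all only: ereal_tendsto_simps1)
  note FTC = interval_integral_FTC_nonneg[of "ereal a" "ereal b" F f A B, OF _ _ _ _ this]
  show "set_integrable lborel {a<..<b} f"
    using FTC(1) assms by simp
  show "(LINT x:{a<..<b}|lborel. f x) = B - A"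
    using FTC(2) assms by (simp add: interval_lebesgue_integral_def)
qed

lemma cell_weight_integral:
  assumes "0 < \<delta>"
  shows "set_integrable lborel {0<..<\<delta>} (cell_weight \<delta> d)"
    and "(LINT u:{0<..<\<delta>}|lborel. cell_weight \<delta> d u) = \<delta> * cell_mean d"
proof -
  consider "d = 0 \<or> d = -1" | "1 \<le> d" | "d \<le> -2" by linarith
  then have "set_integrable lborel {0<..<\<delta>} (cell_weight \<delta> d) \<and>
    (LINT u:{0<..<\<delta>}|lborel. cell_weight \<delta> d u) = \<delta> * cell_mean d"
  proof cases
    case 1
    then have "cell_weight \<delta> d = (\<lambda>_. 2)" "cell_mean d = 2"
      by (auto simp: cell_weight_def cell_mean_def fun_eq_iff)
    then show ?thesis
      using assms by (auto simp: set_integrable_def set_lebesgue_integral_def)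
  next
    case 2
    define w where "w = (of_int d :: real)"
    have w: "1 \<le> w" "of_int d = w" using 2 by (auto simp: w_def)
    have wd: "\<delta> \<le> w * \<delta>" using mult_right_mono[OF w(1), of \<delta>] assms by simp
    have eq: "cell_weight \<delta> d = (\<lambda>u. ln (w * \<delta> / (w * \<delta> - u)))"
      using 2 by (auto simp: cell_weight_def w_def fun_eq_iff)
    let ?F = "\<lambda>u. (w * \<delta> - u) * ln (w * \<delta> - u) - (w * \<delta> - u) * ln (w * \<delta>) + u"
    let ?B = "(w * \<delta> - \<delta>) * ln (w * \<delta> - \<delta>) - (w * \<delta> - \<delta>) * ln (w * \<delta>) + \<delta>"
    \<comment> \<open>Only the adjacent later cell, \<open>w = 1\<close>, is singular; there
      \<open>y * ln y\<close> tends to \<open>0\<close>.\<close>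
    have lim: "((\<lambda>u. (w * \<delta> - u) * ln (w * \<delta> - u)) \<longlongrightarrow> (w * \<delta> - \<delta>) * ln (w * \<delta> - \<delta>)) (at_left \<delta>)"
    proof (cases "w = 1")
      case True
      have "((\<lambda>y::real. y * ln y) \<longlongrightarrow> 0) (at_right 0)" by real_asymp
      moreover have "filterlim (\<lambda>u. \<delta> - u) (at_right 0) (at_left \<delta>)"
        by (auto simp: filterlim_at eventually_at_filter intro!: tendsto_eq_intros)
      ultimately have "((\<lambda>u. (\<delta> - u) * ln (\<delta> - u)) \<longlongrightarrow> 0) (at_left \<delta>)"
        by (rule filterlim_compose)
      with True show ?thesis by simp
    next
      case False
      then have "\<delta> < w * \<delta>" using w assms by simp
      then show ?thesis by (intro tendsto_intros) auto
    qed
    have pos: "0 < w * \<delta> - u" "0 < w * \<delta>" if "u < \<delta>" for u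
      using that wd assms by linarith+
    have D: "(?F has_real_derivative ln (w * \<delta> / (w * \<delta> - u))) (at u)" if "0 < u" "u < \<delta>" for u
      using pos[OF that(2)] by (auto intro!: derivative_eq_intros simp: ln_div)
    have cont: "isCont (\<lambda>u. ln (w * \<delta> / (w * \<delta> - u))) u" if "0 < u" "u < \<delta>" for u
      using pos[OF that(2)] by (intro continuous_intros) auto
    have nonneg: "0 \<le> ln (w * \<delta> / (w * \<delta> - u))" if "0 < u" "u < \<delta>" for u
      using pos[OF that(2)] that by (intro ln_ge_zero) (simp add: field_simps)
    have lim0: "(?F \<longlongrightarrow> ?F 0) (at_right 0)"
      using pos[of 0] assms by (intro tendsto_intros) auto
    have lim1: "(?F \<longlongrightarrow> ?B) (at_left \<delta>)"
      by (intro tendsto_intros lim)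
    note FTC = interval_FTC_nonneg_real[OF assms D cont nonneg lim0 lim1]
    have "?B - ?F 0 = \<delta> * cell_mean d"
    proof -
      have "cell_mean d = 1 - (w - 1) * (ln w - ln (w - 1))"
        using 2 by (simp add: cell_mean_def right_mean_def w_def)
      moreover have "(w * \<delta> - \<delta>) * ln (w * \<delta> - \<delta>) = (w - 1) * \<delta> * (ln (w - 1) + ln \<delta>)"
      proof (cases "w = 1")
        case False
        then have "ln ((w - 1) * \<delta>) = ln (w - 1) + ln \<delta>" using w assms by (intro ln_mult_pos) auto
        then show ?thesis by (simp add: left_diff_distrib)
      qed simp
      moreover have "ln (w * \<delta>) = ln w + ln \<delta>" using w assms by (intro ln_mult_pos) auto
      moreover have "w * \<delta> - \<delta> = (w - 1) * \<delta>" by (simp add: left_diff_distrib)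
      ultimately have "?B = (w - 1) * \<delta> * (ln (w - 1) + ln \<delta>) - (w - 1) * \<delta> * (ln w + ln \<delta>) + \<delta>"
        by simp
      also have "\<dots> = \<delta> * cell_mean d"
        unfolding \<open>cell_mean d = _\<close> by (simp add: algebra_simps)
      finally show ?thesis by simp
    qed
    with FTC show ?thesis unfolding eq using assms by simp
  next
    case 3
    define j where "j = (of_int (- d - 1) :: real)"
    have j: "1 \<le> j" using 3 by (auto simp: j_def)
    have jd: "0 < j * \<delta>" using j assms by simp
    have eq: "cell_weight \<delta> d = (\<lambda>u. ln ((u + j * \<delta>) / (j * \<delta>)))"
      using 3 by (auto simp: cell_weight_def j_def fun_eq_iff)
    let ?F = "\<lambda>u. (u + j * \<delta>) * ln ((u + j * \<delta>) / (j * \<delta>)) - u"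
    have pos: "0 < u + j * \<delta>" if "0 \<le> u" for u using that jd by simp
    have D: "(?F has_real_derivative ln ((u + j * \<delta>) / (j * \<delta>))) (at u)" if "0 < u" "u < \<delta>" for u
      using pos[of u] that assms j by (auto intro!: derivative_eq_intros)
    have cont: "isCont (\<lambda>u. ln ((u + j * \<delta>) / (j * \<delta>))) u" if "0 < u" "u < \<delta>" for u
      using pos[of u] that assms j by (intro continuous_intros) auto
    have nonneg: "0 \<le> ln ((u + j * \<delta>) / (j * \<delta>))" if "0 < u" "u < \<delta>" for u
      using pos[of u] that jd by (intro ln_ge_zero) (simp add: field_simps)
    have lim: "(?F \<longlongrightarrow> ?F v) (at v within S)" if "0 \<le> v" for v S
      using pos[OF that] assms j by (intro tendsto_intros) auto
    note FTC = interval_FTC_nonneg_real[OF assms D cont nonneg lim lim]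
    have "?F \<delta> - ?F 0 = \<delta> * cell_mean d"
    proof -
      have mean: "cell_mean d = (j + 1) * (ln (j + 1) - ln j) - 1"
        using 3 by (simp add: cell_mean_def left_mean_def j_def)
      have "(\<delta> + j * \<delta>) / (j * \<delta>) = (j + 1) / j" using assms j by (simp add: field_simps)
      moreover have "ln ((j + 1) / j) = ln (j + 1) - ln j" using j by (simp add: ln_div)
      moreover have "\<delta> + j * \<delta> = (j + 1) * \<delta>" by (simp add: algebra_simps)
      ultimately have "?F \<delta> = (j + 1) * \<delta> * (ln (j + 1) - ln j) - \<delta>" by simp
      also have "\<dots> = \<delta> * cell_mean d" by (simp add: mean algebra_simps)
      finally have "?F \<delta> = \<delta> * cell_mean d" .
      then show ?thesis using jd by simp
    qed
    with FTC show ?thesis unfolding eq using assms by simp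
  qed
  then show "set_integrable lborel {0<..<\<delta>} (cell_weight \<delta> d)"
    "(LINT u:{0<..<\<delta>}|lborel. cell_weight \<delta> d u) = \<delta> * cell_mean d" by auto
qed

text \<open>Inherited from the integrand, which spares an estimate of the logarithmic
  formulas.\<close>

lemma cell_mean_nonneg: "0 \<le> cell_mean d"
proof -
  have "0 \<le> (LINT u:{0<..<1}|lborel. cell_weight 1 d u)"
    unfolding set_lebesgue_integral_def
    by (intro Bochner_Integration.integral_nonneg) (auto simp: indicator_def cell_weight_nonneg)
  then show ?thesis using cell_weight_integral(2)[of 1 d] by simp
qed

section \<open>Sums of the averaged weights over all cells\<close>

lemma left_mean_nonneg: "0 \<le> left_mean (Suc j)"
  using cell_mean_nonneg[of "- int j - 2"] by (simp add: cell_mean_def nat_add_distrib)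

lemma right_mean_nonneg: "0 \<le> right_mean (Suc w)"
  using cell_mean_nonneg[of "int w + 1"] by (simp add: cell_mean_def nat_add_distrib)

text \<open>
  The sum is explicit because \<open>left_mean j + right_mean (j + 1) = ln (j + 1) - ln j\<close>; its leading
  coefficient \<open>1\<close> is what makes the constant \<open>6\<close> sufficient already for \<open>n = 2\<close>.
\<close>

lemma sum_left_right_mean:
  "(\<Sum>j<N. left_mean (Suc j)) + (\<Sum>w<Suc N. right_mean (Suc w)) = 1 + ln (real N + 1)"
proof (induction N)
  case (Suc N)
  have "left_mean (Suc N) + right_mean (Suc (Suc N)) = ln (real (Suc N) + 1) - ln (real N + 1)"
    by (simp add: left_mean_def right_mean_def algebra_simps)
  with Suc show ?case by simp
qed (simp add: right_mean_def)

text \<open>Time \<open>0\<close> occupies the fictitious cell \<open>-1\<close>: cell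
  \<open>0\<close> is adjacent to it and pays the trivial \<open>2\<close>, every further cell
  \<open>m\<close> pays \<open>left_mean m\<close>. The inequality is strict only for
  \<open>n = 0\<close>.\<close>

lemma sum_cell_mean_left_end:
  "(\<Sum>m<n. cell_mean (-1 - int m)) \<le> 2 + (\<Sum>j<n - 1. left_mean (Suc j))"
proof (cases n)
  case (Suc k)
  show ?thesis unfolding Suc sum.lessThan_Suc_shift
    by (simp add: cell_mean_def nat_add_distrib)
qed simp

lemma sum_cell_mean_right:
  "(\<Sum>m<c. cell_mean (int c - int m)) = (\<Sum>w<c. right_mean (Suc w))"
proof -
  have "(\<Sum>m<c. cell_mean (int c - int m)) = (\<Sum>m<c. right_mean (Suc (c - Suc m)))"
  proof (intro sum.cong refl)
    fix m assume "m \<in> {..<c}"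
    then have "nat (int c - int m) = Suc (c - Suc m)" "1 \<le> int c - int m" by auto
    then show "cell_mean (int c - int m) = right_mean (Suc (c - Suc m))"
      by (simp add: cell_mean_def)
  qed
  also have "\<dots> = (\<Sum>w<c. right_mean (Suc w))"
    by (rule sum.nat_diff_reindex)
  finally show ?thesis .
qed

lemma sum_lessThan_add:
  fixes g :: "nat \<Rightarrow> 'b::comm_monoid_add"
  shows "(\<Sum>m<c + k. g m) = (\<Sum>m<c. g m) + (\<Sum>i<k. g (c + i))"
  by (induction k) (simp_all add: add.assoc)

text \<open>The cells before \<open>c\<close> have the fixed time on their right. Cell
  \<open>c\<close> and, if it exists, its successor pay the trivial \<open>2\<close>. The remaining
  \<open>n - c - 2\<close> cells have the fixed time on their left.\<close>

lemma sum_cell_mean_split: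
  assumes "c < n"
  shows "(\<Sum>m<n. cell_mean (int c - int m))
    = (\<Sum>w<c. right_mean (Suc w)) + 2 + (if Suc c < n then 2 + (\<Sum>j<n - c - 2. left_mean (Suc j)) else 0)"
proof -
  have split: "(\<Sum>m<n. cell_mean (int c - int m))
      = (\<Sum>m<c. cell_mean (int c - int m)) + (\<Sum>i<n - c. cell_mean (- int i))"
    using sum_lessThan_add[of "\<lambda>m. cell_mean (int c - int m)" c "n - c"] assms by simp
  have "(\<Sum>i<n - c. cell_mean (- int i))
      = 2 + (if Suc c < n then 2 + (\<Sum>j<n - c - 2. left_mean (Suc j)) else 0)"
  proof (cases "Suc c < n")
    case True
    then have "n - c = Suc (Suc (n - c - 2))" by simp
    then have "(\<Sum>i<n - c. cell_mean (- int i)) = (\<Sum>i<Suc (Suc (n - c - 2)). cell_mean (- int i))"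
      by simp
    also have "\<dots> = cell_mean 0 + (cell_mean (-1) + (\<Sum>i<n - c - 2. cell_mean (- int (Suc (Suc i)))))"
      by (simp only: sum.lessThan_Suc_shift comp_def) simp
    also have "\<dots> = 2 + (2 + (\<Sum>j<n - c - 2. left_mean (Suc j)))"
      by (simp add: cell_mean_def nat_add_distrib)
    finally show ?thesis using True by simp
  next
    case False
    then have "n - c = 1" using assms by simp
    then show ?thesis using False by (simp add: cell_mean_def)
  qed
  then show ?thesis by (simp add: split sum_cell_mean_right)
qed

lemma ln_ge_two_thirds: "2 \<le> n \<Longrightarrow> 2 / 3 \<le> ln (real n)"
  using ln2_ge_two_thirds ln_le_cancel_iff[of 2 "real n"] by linarith

lemma sum_cell_mean_ends:
  assumes "2 \<le> n"
  shows "(\<Sum>m<n. cell_mean (-1 - int m)) + (\<Sum>m<n. cell_mean (int n - int m)) \<le> 6 * ln (real n)"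
proof -
  obtain k where n: "n = Suc k" using assms by (cases n) auto
  have "(\<Sum>m<n. cell_mean (-1 - int m)) + (\<Sum>m<n. cell_mean (int n - int m)) \<le> 3 + ln (real n)"
    using sum_cell_mean_left_end[of n] sum_cell_mean_right[of n] sum_left_right_mean[of k]
    by (simp add: n add.commute)
  \<comment> \<open>Needed is \<open>3 \<le> 5 * ln n\<close>, which \<open>2 / 3 \<le> ln n\<close>
    supplies.\<close>
  also have "\<dots> \<le> 6 * ln (real n)" using ln_ge_two_thirds[OF assms] by simp
  finally show ?thesis .
qed

text \<open>In general the cost is at most \<open>5 + ln n\<close>, which requires
  \<open>1 \<le> ln n\<close> and hence \<open>n \<ge> 3\<close>. For \<open>n = 2\<close> and
  \<open>c = 0\<close> there are no logarithmic means at all: the cost is exactly \<open>4\<close>,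
  which is six times the lower bound \<open>2 / 3\<close> for \<open>ln 2\<close>. In the last cell
  only one trivial bound is paid.\<close>

lemma sum_cell_mean_inner:
  assumes "2 \<le> n" "c < n"
  shows "(\<Sum>m<n. cell_mean (int c - int m)) \<le> 6 * ln (real n)"
proof -
  have L: "(\<Sum>j<a. left_mean (Suc j)) \<le> (\<Sum>j<b. left_mean (Suc j))" if "a \<le> b" for a b
    using that by (intro sum_mono2) (auto simp: left_mean_nonneg)
  have R: "(\<Sum>j<a. right_mean (Suc j)) \<le> (\<Sum>j<b. right_mean (Suc j))" if "a \<le> b" for a b
    using that by (intro sum_mono2) (auto simp: right_mean_nonneg)
  note ln_n = ln_ge_two_thirds[OF assms(1)]
  obtain k where n: "n = Suc (Suc k)" using assms by (metis add_2_eq_Suc le_Suc_ex)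
  have tot: "(\<Sum>j<k. left_mean (Suc j)) + (\<Sum>w<Suc k. right_mean (Suc w)) \<le> 1 + ln (real n)"
    using sum_left_right_mean[of k] by (simp add: n)
  have L0: "0 \<le> (\<Sum>j<k. left_mean (Suc j))" and R0: "0 \<le> (\<Sum>w<Suc k. right_mean (Suc w))"
    using L[of 0 k] R[of 0 "Suc k"] by auto
  show ?thesis
  proof (cases "Suc c < n")
    case False
    then have "c = Suc k" using assms(2) n by simp
    then have "(\<Sum>m<n. cell_mean (int c - int m)) = (\<Sum>w<Suc k. right_mean (Suc w)) + 2"
      using sum_cell_mean_split[OF assms(2)] False by simp
    then show ?thesis using tot L0 ln_n by linarith
  next
    case True
    note split = sum_cell_mean_split[OF assms(2)]
    show ?thesis
    proof (cases "k = 0")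
      case True
      then have "c = 0" using \<open>Suc c < n\<close> n by simp
      then show ?thesis using True split ln_n n by simp
    next
      case False
      have "exp 1 \<le> (3::real)" by (rule exp_le)
      then have "1 \<le> ln (3::real)" using ln_ge_iff by simp
      also have "\<dots> \<le> ln (real n)" using False n by simp
      finally have "1 \<le> ln (real n)" .
      moreover have "(\<Sum>m<n. cell_mean (int c - int m))
          \<le> (\<Sum>w<Suc k. right_mean (Suc w)) + 4 + (\<Sum>j<k. left_mean (Suc j))"
        using split True L[of "n - c - 2" k] R[of c "Suc k"] n by simp
      ultimately show ?thesis using tot by linarith
    qed
  qed
qed

section \<open>Variation of the transition density in time\<close>

text \<open>Differentiability alone does not make \<open>deriv p\<close> Lebesgue integrable. The
  increment is therefore a gauge integral, whose fundamental theorem asks for no continuity, and the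
  dominating \<open>r\<close> leads back to a Lebesgue integral.\<close>

lemma abs_increment_le_nn_integral:
  fixes p r :: "real \<Rightarrow> real"
  assumes "s \<le> t"
    and diff: "\<And>u. u \<in> {s..t} \<Longrightarrow> p differentiable (at u)"
    and bound: "\<And>u. u \<in> {s..t} \<Longrightarrow> \<bar>deriv p u\<bar> \<le> r u"
    and r: "r \<in> borel_measurable borel" "\<And>u. 0 \<le> r u"
  shows "ennreal \<bar>p t - p s\<bar> \<le> (\<integral>\<^sup>+u. ennreal (r u) \<partial>lborel)"
proof (cases "(\<integral>\<^sup>+u. ennreal (r u) \<partial>lborel)" rule: ennreal_cases)
  case (real v)
  have v: "(r has_integral v) UNIV"
    using real r by (intro nn_integral_has_integral)
  have "(deriv p has_integral (p t - p s)) {s..t}"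
  proof (rule fundamental_theorem_of_calculus[OF \<open>s \<le> t\<close>])
    fix u assume "u \<in> {s..t}"
    then have "(p has_real_derivative deriv p u) (at u)"
      using diff DERIV_deriv_iff_real_differentiable by blast
    then show "(p has_vector_derivative deriv p u) (at u within {s..t})"
      by (simp add: has_real_derivative_iff_has_vector_derivative has_vector_derivative_at_within)
  qed
  moreover have "r integrable_on {s..t}"
    using v integrable_on_subinterval[of r UNIV s t] by (auto simp: has_integral_iff)
  ultimately have "norm (p t - p s) \<le> integral {s..t} r"
    using integral_norm_bound_integral[of "deriv p" "{s..t}" r] bound
    by (auto simp: has_integral_iff)
  also have "\<dots> \<le> integral UNIV r"
    using v \<open>r integrable_on {s..t}\<close> r by (intro integral_subset_le) (auto simp: has_integral_iff)
  also have "\<dots> = v" using v by (simp add: has_integral_iff)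
  finally show ?thesis using real by (simp add: ennreal_leI)
qed simp

text \<open>Integrating the derivative bound over \<open>y\<close> first uses up the density
  \<open>q\<close>, which has mass \<open>1\<close>; what remains is the integral of
  \<open>C / u\<close> from \<open>s\<close> to \<open>t\<close>, hence the logarithm.\<close>

lemma condition_X_tv_estimate:
  fixes X :: "real \<Rightarrow> 'w \<Rightarrow> 'e::euclidean_space"
  assumes markov: "markov_process M X P" and cond: "condition_X X P T C"
    and st: "0 < s" "s \<le> t" "t \<le> T"
    and \<psi>: "\<psi> \<in> borel_measurable borel" "\<And>y. \<bar>\<psi> y\<bar> \<le> K"
  shows "\<bar>(\<integral>\<omega>. \<psi> (X t \<omega>) \<partial>P x) - (\<integral>\<omega>. \<psi> (X s \<omega>) \<partial>P x)\<bar> \<le> C * ln (t / s) * K"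
proof -
  from cond obtain p q where C: "1 \<le> C"
    and p: "transition_density X P p"
    and diff: "\<And>u y. 0 < u \<Longrightarrow> (\<lambda>s. p s x y) differentiable (at u)"
    and q_meas: "(\<lambda>(t, x, y). q t x y) \<in> borel_measurable (restrict_space borel ({0<..T} \<times> UNIV \<times> UNIV))"
    and q: "\<And>u y. u \<in> {0<..T} \<Longrightarrow> 0 \<le> q u x y"
      "\<And>u. u \<in> {0<..T} \<Longrightarrow> prob_space (density lborel (\<lambda>y. ennreal (q u x y)))"
    and bound: "\<And>u y. u \<in> {0<..T} \<Longrightarrow> \<bar>deriv (\<lambda>s. p s x y) u\<bar> \<le> C * inverse u * q u x y"
    unfolding condition_X_def by blast
  have K: "0 \<le> K" using order_trans[OF abs_ge_zero \<psi>(2)] .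
  have p0: "0 \<le> p u x y" and pd: "distributed (P x) lborel (X u) (\<lambda>y. ennreal (p u x y))"
    if "0 < u" for u y using p that unfolding transition_density_def by auto
  have p_meas: "(\<lambda>y. p u x y) \<in> borel_measurable borel" if "0 < u" for u
    using distributed_real_measurable[OF _ pd[OF that]] p0[OF that] by simp
  have p_prob: "(\<integral>\<^sup>+y. ennreal (p u x y) \<partial>lborel) = emeasure (P x) (space (P x))" if "0 < u" for u
    using distributed_nn_integral[OF pd[OF that], of "\<lambda>_. 1"] by simp
  \<comment> \<open>The indicator extends the bound by zero to all times, so that it is nonnegative
    and jointly measurable everywhere although \<open>q\<close> is controlled only on
    \<open>{0<..T}\<close>.\<close>
  define r where "r u y = indicator {s..t} u * (C * inverse u * q u x y)" for u y
  have q_meas': "(\<lambda>z. indicator ({0<..T} \<times> UNIV \<times> UNIV) z * (case z of (t, x, y) \<Rightarrow> q t x y))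
      \<in> borel_measurable borel"
  proof -
    have "{0<..T} \<times> (UNIV :: 'e set) \<times> (UNIV :: 'e set) \<in> sets (borel \<Otimes>\<^sub>M (borel \<Otimes>\<^sub>M borel))"
      by (intro pair_measureI) auto
    then have "{0<..T} \<times> (UNIV :: 'e set) \<times> (UNIV :: 'e set) \<in> sets borel"
      by (simp only: borel_prod)
    then show ?thesis
      using q_meas by (subst (asm) borel_measurable_restrict_space_iff) simp_all
  qed
  have r_meas: "case_prod r \<in> borel_measurable (borel \<Otimes>\<^sub>M borel)"
  proof -
    have "(\<lambda>(u, y). (u, x, y)) \<in> (borel \<Otimes>\<^sub>M borel) \<rightarrow>\<^sub>M (borel \<Otimes>\<^sub>M (borel \<Otimes>\<^sub>M borel))"
      by measurable
    moreover have "borel \<Otimes>\<^sub>M (borel \<Otimes>\<^sub>M borel) = (borel :: (real \<times> 'e \<times> 'e) measure)"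
      by (simp only: borel_prod)
    ultimately have "(\<lambda>(u, y). (u, x, y)) \<in> (borel \<Otimes>\<^sub>M borel) \<rightarrow>\<^sub>M (borel :: (real \<times> 'e \<times> 'e) measure)"
      by simp
    from measurable_compose[OF this q_meas']
    have *: "(\<lambda>(u, y). indicator {0<..T} u * q u x y) \<in> borel_measurable (borel \<Otimes>\<^sub>M borel)"
      by (simp add: case_prod_beta' indicator_times)
    have "(\<lambda>z. indicator {s..t} (fst z) * (C * inverse (fst z)) * (case z of (u, y) \<Rightarrow> indicator {0<..T} u * q u x y))
       \<in> borel_measurable (borel \<Otimes>\<^sub>M borel)"
      by (intro borel_measurable_times *) measurable
    also have "(\<lambda>z. indicator {s..t} (fst z) * (C * inverse (fst z)) * (case z of (u, y) \<Rightarrow> indicator {0<..T} u * q u x y))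
       = case_prod r"
      using st by (auto simp: r_def fun_eq_iff indicator_def)
    finally show ?thesis .
  qed
  have r0: "0 \<le> r u y" for u y
    using q(1)[of u y] C st by (auto simp: r_def indicator_def)
  have "ennreal \<bar>p t x y - p s x y\<bar> \<le> (\<integral>\<^sup>+u. ennreal (r u y) \<partial>lborel)" for y
  proof (rule abs_increment_le_nn_integral[of s t "\<lambda>u. p u x y"])
    show "(\<lambda>u. r u y) \<in> borel_measurable borel"
      using measurable_compose[OF measurable_Pair2' r_meas, of y] by simp
    show "\<bar>deriv (\<lambda>s. p s x y) u\<bar> \<le> r u y" if "u \<in> {s..t}" for u
      using bound[of u y] that st by (simp add: r_def)
  qed (use st diff r0 in auto)
  then have "(\<integral>\<^sup>+y. ennreal \<bar>p t x y - p s x y\<bar> \<partial>lborel) \<le> (\<integral>\<^sup>+y. \<integral>\<^sup>+u. ennreal (r u y) \<partial>lborel \<partial>lborel)"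
    by (intro nn_integral_mono)
  also have "\<dots> = (\<integral>\<^sup>+u. \<integral>\<^sup>+y. ennreal (r u y) \<partial>lborel \<partial>lborel)"
    using r_meas by (intro lborel_pair.Fubini') (simp add: case_prod_beta' measurable_lborel1)
  also have "\<dots> = (\<integral>\<^sup>+u. ennreal (C / u) * indicator {s..t} u \<partial>lborel)"
  proof (intro nn_integral_cong)
    fix u
    show "(\<integral>\<^sup>+y. ennreal (r u y) \<partial>lborel) = ennreal (C / u) * indicator {s..t} u"
    proof (cases "u \<in> {s..t}")
      case True
      with st have u: "u \<in> {0<..T}" "0 < u" by auto
      interpret prob_space "density lborel (\<lambda>y. ennreal (q u x y))" by (rule q(2)[OF u(1)])
      \<comment> \<open>Measurability of \<open>q u x\<close> is recovered from a slice of
        \<open>r\<close> by undoing the factor \<open>C / u\<close>.\<close>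
      have "(\<lambda>y. r u y) \<in> borel_measurable borel"
        using measurable_compose[OF measurable_Pair1' r_meas, of u] by simp
      then have "(\<lambda>y. r u y * (u / C)) \<in> borel_measurable borel" by simp
      also have "(\<lambda>y. r u y * (u / C)) = q u x" using True u C by (auto simp: r_def fun_eq_iff)
      finally have qm: "q u x \<in> borel_measurable borel" .
      then have "(\<integral>\<^sup>+y. ennreal (q u x y) \<partial>lborel) = 1"
        using emeasure_space_1 by (simp add: emeasure_density)
      moreover have "ennreal (r u y) = ennreal (C / u) * ennreal (q u x y)" for y
        using True u C q(1)[OF u(1), of y] by (simp add: r_def ennreal_mult[symmetric] field_simps)
      ultimately show ?thesis using True qm by (simp add: nn_integral_cmult)
    qed (simp add: r_def)
  qed
  also have "\<dots> = ennreal (C * ln t - C * ln s)"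
    using st C
    by (intro nn_integral_FTC_Icc[where F="\<lambda>u. C * ln u"]) (auto intro!: derivative_eq_intros)
  finally have tv: "(\<integral>\<^sup>+y. ennreal \<bar>p t x y - p s x y\<bar> \<partial>lborel) \<le> ennreal (C * ln (t / s))"
    using st by (simp add: ln_div right_diff_distrib)
  have int_diff: "integrable lborel (\<lambda>y. \<bar>p t x y - p s x y\<bar>)"
    using tv p_meas st by (intro integrableI_bounded) (auto simp: ennreal_less_top intro: le_less_trans)
  have L1: "(\<integral>y. \<bar>p t x y - p s x y\<bar> \<partial>lborel) \<le> C * ln (t / s)"
    using tv p_meas st C by (subst integral_eq_nn_integral) (auto intro!: enn2real_leI)
  interpret prob_space "P x" using markov by (rule markov_process.prob_law)
  have int: "integrable lborel (\<lambda>y. p u x y * \<psi> y)" if "0 < u" for u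
  proof (subst distributed_integrable[OF pd[OF that]])
    have "(\<lambda>\<omega>. \<psi> (X u \<omega>)) \<in> borel_measurable (P x)"
      using measurable_compose[OF distributed_measurable[OF pd[OF that]]] \<psi> by simp
    then show "integrable (P x) (\<lambda>\<omega>. \<psi> (X u \<omega>))"
      using \<psi> by (intro integrable_const_bound[of _ K]) auto
  qed (use \<psi> p0 that in auto)
    have "(\<integral>\<omega>. \<psi> (X t \<omega>) \<partial>P x) - (\<integral>\<omega>. \<psi> (X s \<omega>) \<partial>P x)
        = (\<integral>y. p t x y * \<psi> y \<partial>lborel) - (\<integral>y. p s x y * \<psi> y \<partial>lborel)"
      using distributed_integral[OF pd[of t], of \<psi>] distributed_integral[OF pd[of s], of \<psi>] \<psi> st p0 by simp
    also have "\<dots> = (\<integral>y. (p t x y - p s x y) * \<psi> y \<partial>lborel)"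
      using int st by (simp add: left_diff_distrib)
    finally have "\<bar>(\<integral>\<omega>. \<psi> (X t \<omega>) \<partial>P x) - (\<integral>\<omega>. \<psi> (X s \<omega>) \<partial>P x)\<bar> = \<bar>\<integral>y. (p t x y - p s x y) * \<psi> y \<partial>lborel\<bar>"
      by simp
    also have "\<dots> \<le> (\<integral>y. \<bar>(p t x y - p s x y) * \<psi> y\<bar> \<partial>lborel)"
      by (rule integral_abs_bound)
    also have "\<dots> \<le> (\<integral>y. \<bar>p t x y - p s x y\<bar> * K \<partial>lborel)"
    proof (intro integral_mono)
      show "integrable lborel (\<lambda>y. \<bar>(p t x y - p s x y) * \<psi> y\<bar>)"
        using int[of t] int[of s] st by (intro integrable_abs) (simp add: left_diff_distrib)
    qed (use int_diff \<psi> in \<open>auto simp: abs_mult intro!: mult_left_mono\<close>)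
    also have "\<dots> \<le> C * ln (t / s) * K"
      using L1 K by (simp add: mult_right_mono)
    finally show ?thesis .
qed

section \<open>The Markov property for bounded functionals\<close>

context markov_process
begin

section \<open>Measurability under the laws and with respect to the past\<close>

lemma space_law: "space (P x) = space M"
  by (rule sets_eq_imp_space_eq[OF sets_law])

lemma measurable_law_iff: "measurable (P x) N = measurable M N"
  by (rule measurable_cong_sets[OF sets_law refl])

lemma measurable_X: "0 \<le> t \<Longrightarrow> X t \<in> measurable M borel"
  using measurable_compose[OF measurable_Pair1' measurable_process, of t]
  by (simp add: space_restrict_space)

lemma measurable_comp_X:
  "0 \<le> t \<Longrightarrow> \<psi> \<in> measurable borel N \<Longrightarrow> (\<lambda>\<omega>. \<psi> (X t \<omega>)) \<in> measurable M N"
  by (rule measurable_compose[OF measurable_X])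

lemma integrable_bounded:
  fixes F :: "'w \<Rightarrow> real"
  assumes "F \<in> borel_measurable M" "\<And>\<omega>. \<bar>F \<omega>\<bar> \<le> B"
  shows "integrable (P x) F"
proof -
  interpret prob_space "P x" by (rule prob_law)
  show ?thesis
    using assms by (intro integrable_const_bound[of _ B]) (auto simp: measurable_law_iff)
qed

lemma abs_expectation_le:
  fixes F :: "'w \<Rightarrow> real"
  assumes "F \<in> borel_measurable M" "\<And>\<omega>. \<omega> \<in> space M \<Longrightarrow> \<bar>F \<omega>\<bar> \<le> B"
  shows "\<bar>\<integral>\<omega>. F \<omega> \<partial>P x\<bar> \<le> B"
proof -
  interpret prob_space "P x" by (rule prob_law)
  have int: "integrable (P x) F"
    using assms by (intro integrable_const_bound[of _ B]) (auto simp: measurable_law_iff space_law)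
  have "\<bar>\<integral>\<omega>. F \<omega> \<partial>P x\<bar> \<le> (\<integral>\<omega>. \<bar>F \<omega>\<bar> \<partial>P x)"
    by (rule integral_abs_bound)
  also have "\<dots> \<le> (\<integral>\<omega>. B \<partial>P x)"
    using assms int by (intro integral_mono) (auto simp: space_law)
  finally show ?thesis by (simp add: prob_space)
qed

abbreviation past :: "real \<Rightarrow> 'w measure" where
  "past \<equiv> natural_filtration M X"

lemma space_past: "space (past s) = space M"
  unfolding natural_filtration_def by (auto intro!: space_measure_of)

lemma sets_past:
  "sets (past s) = sigma_sets (space M)
     {X u -` A \<inter> space M |u A. 0 \<le> u \<and> u \<le> s \<and> A \<in> sets borel}"
  unfolding natural_filtration_def by (auto intro!: sets_measure_of)

lemma subalgebra_past: "subalgebra (P x) (past s)"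
  unfolding subalgebra_def space_past space_law sets_past sets_law
  by (auto intro!: sets.sigma_sets_subset measurable_sets[OF measurable_X])

lemma measurable_past_mono:
  assumes "F \<in> measurable (past s) N" "s \<le> t"
  shows "F \<in> measurable (past t) N"
proof (rule measurable_from_subalg[OF _ assms(1)])
  show "subalgebra (past t) (past s)"
    unfolding subalgebra_def space_past sets_past using assms(2)
    by (auto intro!: sigma_sets_mono') (metis order_trans)
qed

lemma measurable_past_M: "F \<in> measurable (past s) N \<Longrightarrow> F \<in> measurable M N"
  using measurable_from_subalg[OF subalgebra_past] by (simp add: measurable_law_iff)

lemma measurable_X_past: "0 \<le> u \<Longrightarrow> u \<le> s \<Longrightarrow> X u \<in> measurable (past s) borel"
  by (rule measurableI) (auto simp: space_past sets_past intro!: sigma_sets.Basic)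

text \<open>The transition semigroup, defined through the laws because a density is given only for
  positive times while time \<open>0\<close> occurs below.\<close>

definition transition_op :: "real \<Rightarrow> ('e \<Rightarrow> real) \<Rightarrow> 'e \<Rightarrow> real" where
  "transition_op t \<psi> y = (\<integral>\<omega>. \<psi> (X t \<omega>) \<partial>P y)"

lemma abs_transition_op_le:
  assumes "0 \<le> t" "\<psi> \<in> borel_measurable borel" "\<And>y. \<bar>\<psi> y\<bar> \<le> K"
  shows "\<bar>transition_op t \<psi> y\<bar> \<le> K"
  unfolding transition_op_def
  by (rule abs_expectation_le) (use assms measurable_comp_X in auto)

lemma transition_op_diff:
  assumes "0 \<le> t" "\<psi> \<in> borel_measurable borel" "\<And>y. \<bar>\<psi> y\<bar> \<le> K"
    and "\<phi> \<in> borel_measurable borel" "\<And>y. \<bar>\<phi> y\<bar> \<le> L"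
  shows "transition_op t (\<lambda>z. \<psi> z - \<phi> z) y = transition_op t \<psi> y - transition_op t \<phi> y"
  unfolding transition_op_def using assms measurable_comp_X
  by (intro Bochner_Integration.integral_diff integrable_bounded) auto

text \<open>The locale provides measurability for indicators only. It makes
  \<open>distr (P y) borel (X t)\<close> a measurable kernel in \<open>y\<close>, and kernels
  preserve measurability of nonnegative integrals; adding \<open>K\<close> makes
  \<open>\<psi>\<close> nonnegative.\<close>

lemma measurable_transition_op:
  assumes t: "0 \<le> t" and \<psi>: "\<psi> \<in> borel_measurable borel" and K: "\<And>y. \<bar>\<psi> y\<bar> \<le> K"
  shows "transition_op t \<psi> \<in> borel_measurable borel"
proof -
  have X: "X t \<in> measurable (P y) borel" for y
    using measurable_X[OF t] by (simp add: measurable_law_iff)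
  have "(\<lambda>y. distr (P y) borel (X t)) \<in> measurable borel (prob_algebra borel)"
  proof (rule measurable_prob_algebraI)
    show "prob_space (distr (P y) borel (X t))" for y
      by (rule prob_space.prob_space_distr[OF prob_law X])
    show "(\<lambda>y. distr (P y) borel (X t)) \<in> measurable borel (subprob_algebra borel)"
    proof (rule measurable_subprob_algebra)
      show "subprob_space (distr (P y) borel (X t))" for y
        by (intro prob_space_imp_subprob_space prob_space.prob_space_distr[OF prob_law X])
      fix A :: "'e set" assume A: "A \<in> sets borel"
      have "emeasure (distr (P y) borel (X t)) A = ennreal (measure (P y) (X t -` A \<inter> space M))" for y
      proof -
        interpret prob_space "P y" by (rule prob_law)
        show ?thesis
          using A X by (simp add: emeasure_distr space_law emeasure_eq_measure)
      qed
      then show "(\<lambda>y. emeasure (distr (P y) borel (X t)) A) \<in> borel_measurable borel"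
        using measurable_transition[OF t A] by simp
    qed simp
  qed
  from measurable_compose[OF measurable_prob_algebraD[OF this] nn_integral_measurable_subprob_algebra]
  have "(\<lambda>y. enn2real (\<integral>\<^sup>+z. ennreal (\<psi> z + K) \<partial>distr (P y) borel (X t)) - K) \<in> borel_measurable borel"
    using \<psi> by simp
  also have "(\<lambda>y. enn2real (\<integral>\<^sup>+z. ennreal (\<psi> z + K) \<partial>distr (P y) borel (X t)) - K) = transition_op t \<psi>"
  proof
    fix y
    interpret prob_space "P y" by (rule prob_law)
    have nonneg: "0 \<le> \<psi> z + K" for z using K[of z] by linarith
    have int: "integrable (P y) (\<lambda>\<omega>. \<psi> (X t \<omega>))"
      using t \<psi> K measurable_comp_X by (intro integrable_bounded) auto
    have "(\<integral>\<^sup>+z. ennreal (\<psi> z + K) \<partial>distr (P y) borel (X t)) = (\<integral>\<^sup>+\<omega>. ennreal (\<psi> (X t \<omega>) + K) \<partial>P y)"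
      using X \<psi> by (intro nn_integral_distr) auto
    also have "\<dots> = ennreal (\<integral>\<omega>. \<psi> (X t \<omega>) + K \<partial>P y)"
      using int nonneg by (intro nn_integral_eq_integral) auto
    also have "(\<integral>\<omega>. \<psi> (X t \<omega>) + K \<partial>P y) = transition_op t \<psi> y + K"
      using int by (simp add: transition_op_def prob_space)
    finally show "enn2real (\<integral>\<^sup>+z. ennreal (\<psi> z + K) \<partial>distr (P y) borel (X t)) - K = transition_op t \<psi> y"
      using abs_transition_op_le[OF t \<psi> K, of y] by (simp add: enn2real_ennreal)
  qed
  finally show ?thesis .
qed

text \<open>Integrating a conditional expectation against a bounded factor \<open>F\<close> of the
  past replaces the almost sure identity of the locale by one between expectations.\<close>

lemma markov_expectation_indicator:
  assumes "0 \<le> s" "0 \<le> t" "A \<in> sets borel"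
    and F: "F \<in> borel_measurable (past s)" "\<And>\<omega>. \<bar>F \<omega>\<bar> \<le> B"
  shows "(\<integral>\<omega>. F \<omega> * indicator A (X (s + t) \<omega>) \<partial>P x)
       = (\<integral>\<omega>. F \<omega> * transition_op t (indicator A) (X s \<omega>) \<partial>P x)"
proof -
  interpret prob_space "P x" by (rule prob_law)
  interpret finite_measure_subalgebra "P x" "past s"
    by unfold_locales (rule subalgebra_past)
  have XA: "(\<lambda>\<omega>. indicator A (X (s + t) \<omega>) :: real) \<in> borel_measurable M"
    using assms by (intro measurable_comp_X) auto
  have F': "F \<in> borel_measurable M" by (rule measurable_past_M[OF F(1)])
  have "integrable (P x) (\<lambda>\<omega>. F \<omega> * indicator A (X (s + t) \<omega>))"
    using F F' XA by (intro integrable_bounded[where B=B])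
      (auto simp: indicator_def intro: order_trans[OF abs_ge_zero])
  then have "(\<integral>\<omega>. F \<omega> * indicator A (X (s + t) \<omega>) \<partial>P x) =
      (\<integral>\<omega>. F \<omega> * real_cond_exp (P x) (past s) (\<lambda>\<omega>'. indicator A (X (s + t) \<omega>')) \<omega> \<partial>P x)"
    using F XA by (intro real_cond_exp_intg(2)[symmetric]) (auto simp: measurable_law_iff)
  also have "\<dots> = (\<integral>\<omega>. F \<omega> * measure (P (X s \<omega>)) (X t -` A \<inter> space M) \<partial>P x)"
  proof (rule integral_cong_AE)
    show "(\<lambda>\<omega>. F \<omega> * measure (P (X s \<omega>)) (X t -` A \<inter> space M)) \<in> borel_measurable (P x)"
      using F' measurable_comp_X[OF _ measurable_transition] assms
      by (simp add: measurable_law_iff)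
    show "AE \<omega> in P x. F \<omega> * real_cond_exp (P x) (past s) (\<lambda>\<omega>'. indicator A (X (s + t) \<omega>')) \<omega>
        = F \<omega> * measure (P (X s \<omega>)) (X t -` A \<inter> space M)"
      using markov_property[OF assms(1-3), of x] by eventually_elim simp
    show "(\<lambda>\<omega>. F \<omega> * real_cond_exp (P x) (past s) (\<lambda>\<omega>'. indicator A (X (s + t) \<omega>')) \<omega>)
        \<in> borel_measurable (P x)"
      unfolding measurable_law_iff using F'
      by (intro borel_measurable_times measurable_past_M[OF borel_measurable_cond_exp])
  qed
  also have "(\<lambda>\<omega>. measure (P (X s \<omega>)) (X t -` A \<inter> space M))
      = (\<lambda>\<omega>. transition_op t (indicator A) (X s \<omega>))"
  proof
    fix \<omega>
    have "X t -` A \<inter> space M \<in> sets M"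
      using measurable_X[OF assms(2)] assms(3) by auto
    then have "measure (P (X s \<omega>)) (X t -` A \<inter> space M)
        = (\<integral>\<omega>'. indicator (X t -` A \<inter> space M) \<omega>' \<partial>P (X s \<omega>))"
      by (simp add: sets_law space_law Int_absorb2 sets.sets_into_space)
    also have "\<dots> = transition_op t (indicator A) (X s \<omega>)"
      unfolding transition_op_def
      by (intro Bochner_Integration.integral_cong) (auto simp: space_law indicator_def)
    finally show "measure (P (X s \<omega>)) (X t -` A \<inter> space M)
        = transition_op t (indicator A) (X s \<omega>)" .
  qed
  finally show ?thesis .
qed

text \<open>From indicators to nonnegative Borel functions by monotone approximation. The bound
  \<open>K\<close> varies in the induction because a multiple \<open>c * u\<close> refers to
  \<open>u\<close> with the bound \<open>K / c\<close>.\<close>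

lemma markov_expectation_nonneg:
  assumes s: "0 \<le> s" and t: "0 \<le> t"
    and F: "F \<in> borel_measurable (past s)" "\<And>\<omega>. \<bar>F \<omega>\<bar> \<le> B"
    and \<psi>: "\<psi> \<in> borel_measurable borel" "\<And>y. 0 \<le> \<psi> y" and "\<And>y. \<psi> y \<le> K"
  shows "(\<integral>\<omega>. F \<omega> * \<psi> (X (s + t) \<omega>) \<partial>P x)
       = (\<integral>\<omega>. F \<omega> * transition_op t \<psi> (X s \<omega>) \<partial>P x)"
  using \<psi> \<open>\<And>y. \<psi> y \<le> K\<close>
proof (induction arbitrary: K rule: borel_measurable_induct_real)
  case (set A)
  then show ?case using markov_expectation_indicator[OF s t _ F] by simp
next
  case (mult u c)
  show ?case
  proof (cases "c = 0")
    case False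
    with mult.prems have "u y \<le> K / c" for y
      using \<open>0 \<le> c\<close> by (simp add: field_simps)
    from mult.IH[OF this] show ?thesis
      by (simp add: transition_op_def mult.left_commute)
  qed (simp add: transition_op_def)
next
  case (add u v)
  have u: "u y \<le> K" and v: "v y \<le> K" for y
    using add.prems[of y] add.hyps(2,4)[of y] by auto
  have B: "0 \<le> B" using F(2) order_trans[OF abs_ge_zero] by blast
  have F': "F \<in> borel_measurable M" by (rule measurable_past_M[OF F(1)])
  have int: "integrable (P x) (\<lambda>\<omega>. F \<omega> * w (X r \<omega>))"
    if "w \<in> borel_measurable borel" "\<And>y. \<bar>w y\<bar> \<le> K" "0 \<le> r" for w r x
    using that F F' B
    by (intro integrable_bounded[where B="B * K"] borel_measurable_times measurable_comp_X)
      (auto simp: abs_mult intro!: mult_mono)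
  have op: "transition_op t (\<lambda>z. v z + u z) y = transition_op t v y + transition_op t u y" for y
    unfolding transition_op_def using add.hyps u v t
    by (intro Bochner_Integration.integral_add integrable_bounded[where B=K] measurable_comp_X) auto
  have w: "transition_op t w \<in> borel_measurable borel" "\<bar>transition_op t w y\<bar> \<le> K"
    if "w \<in> borel_measurable borel" "\<And>y. 0 \<le> w y" "\<And>y. w y \<le> K" for w y
    using that t by (auto intro!: measurable_transition_op[where K=K] abs_transition_op_le)
  have au: "\<bar>u y\<bar> \<le> K" and av: "\<bar>v y\<bar> \<le> K" for y
    using u v add.hyps(2,4) by auto
  have "(\<integral>\<omega>. F \<omega> * (v (X (s + t) \<omega>) + u (X (s + t) \<omega>)) \<partial>P x)
      = (\<integral>\<omega>. F \<omega> * v (X (s + t) \<omega>) \<partial>P x) + (\<integral>\<omega>. F \<omega> * u (X (s + t) \<omega>) \<partial>P x)"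
    unfolding distrib_left using s t
    by (intro Bochner_Integration.integral_add int[of v "s + t", OF add.hyps(3) av]
        int[of u "s + t", OF add.hyps(1) au]) simp_all
  also have "\<dots> = (\<integral>\<omega>. F \<omega> * transition_op t v (X s \<omega>) \<partial>P x)
      + (\<integral>\<omega>. F \<omega> * transition_op t u (X s \<omega>) \<partial>P x)"
    by (simp only: add.IH(1)[OF u] add.IH(2)[OF v])
  also have "\<dots> = (\<integral>\<omega>. F \<omega> * transition_op t (\<lambda>z. v z + u z) (X s \<omega>) \<partial>P x)"
    unfolding op distrib_left
    by (intro Bochner_Integration.integral_add[symmetric] s
        int[of "transition_op t v" s, OF w(1)[OF add.hyps(3,4) v] w(2)[OF add.hyps(3,4) v]]
        int[of "transition_op t u" s, OF w(1)[OF add.hyps(1,2) u] w(2)[OF add.hyps(1,2) u]])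
  finally show ?case .
next
  case (seq U)
  have F': "F \<in> borel_measurable M" by (rule measurable_past_M[OF F(1)])
  have B: "0 \<le> B" using F(2) order_trans[OF abs_ge_zero] by blast
  have UK: "U i y \<le> K" for i y
  proof -
    have "incseq (\<lambda>i. U i y)" using seq.hyps(3) by (auto simp: incseq_def le_fun_def)
    from incseq_le[OF this seq.hyps(4)] have "U i y \<le> \<psi> y" by simp
    then show ?thesis using seq.prems[of y] by simp
  qed
  have aU: "\<bar>U i y\<bar> \<le> K" for i y using UK[of i y] seq.hyps(2)[of i y] by linarith
  have \<psi>: "\<psi> \<in> borel_measurable borel"
    by (rule borel_measurable_LIMSEQ_real[OF seq.hyps(4,1)])
  have K: "0 \<le> K" using order_trans[OF abs_ge_zero aU] .
  have psi_le: "\<bar>\<psi> y\<bar> \<le> K" for y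
    by (rule LIMSEQ_le_const2[OF tendsto_rabs[OF seq.hyps(4)]]) (auto intro: aU)
  \<comment> \<open>Serves three times: for the semigroup itself, with \<open>G = 1\<close> under
    the law \<open>P y\<close>, and for the two sides of the claim.\<close>
  have lim: "(\<lambda>i. \<integral>\<omega>. G \<omega> * w i (X r \<omega>) \<partial>P z) \<longlonglongrightarrow> (\<integral>\<omega>. G \<omega> * w' (X r \<omega>) \<partial>P z)"
    if "G \<in> borel_measurable M" "\<And>\<omega>. \<bar>G \<omega>\<bar> \<le> B'" "0 \<le> r"
      "\<And>i. w i \<in> borel_measurable borel" "w' \<in> borel_measurable borel"
      "\<And>i y. \<bar>w i y\<bar> \<le> K" "\<And>y. (\<lambda>i. w i y) \<longlonglongrightarrow> w' y" for G B' w w' r z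
  proof (rule integral_dominated_convergence[where w="\<lambda>_. B' * K"])
    interpret prob_space "P z" by (rule prob_law)
    show "integrable (P z) (\<lambda>_. B' * K)" by simp
    show "(\<lambda>\<omega>. G \<omega> * w' (X r \<omega>)) \<in> borel_measurable (P z)"
      unfolding measurable_law_iff using that by (intro borel_measurable_times measurable_comp_X)
    show "(\<lambda>\<omega>. G \<omega> * w i (X r \<omega>)) \<in> borel_measurable (P z)" for i
      unfolding measurable_law_iff using that by (intro borel_measurable_times measurable_comp_X)
    show "AE \<omega> in P z. (\<lambda>i. G \<omega> * w i (X r \<omega>)) \<longlonglongrightarrow> G \<omega> * w' (X r \<omega>)"
      by (intro AE_I2 tendsto_mult_left that(7))
    have "0 \<le> B'" using that(2) order_trans[OF abs_ge_zero] by blast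
    then show "AE \<omega> in P z. norm (G \<omega> * w i (X r \<omega>)) \<le> B' * K" for i
      using that(2,6) K by (intro AE_I2) (simp add: abs_mult mult_mono)
  qed
  have op: "(\<lambda>i. transition_op t (U i) y) \<longlonglongrightarrow> transition_op t \<psi> y" for y
    using lim[of "\<lambda>_. 1" 1 t U \<psi> y, OF _ _ t seq.hyps(1) \<psi> aU] seq.hyps(4)
    by (simp add: transition_op_def)
  have lim1: "(\<lambda>i. \<integral>\<omega>. F \<omega> * U i (X (s + t) \<omega>) \<partial>P x) \<longlonglongrightarrow> (\<integral>\<omega>. F \<omega> * \<psi> (X (s + t) \<omega>) \<partial>P x)"
    using s t seq.hyps(4) by (intro lim[where w=U and w'=\<psi> and r="s + t", OF F' F(2) _ seq.hyps(1) \<psi> aU]) simp_all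
  have lim2: "(\<lambda>i. \<integral>\<omega>. F \<omega> * transition_op t (U i) (X s \<omega>) \<partial>P x)
      \<longlonglongrightarrow> (\<integral>\<omega>. F \<omega> * transition_op t \<psi> (X s \<omega>) \<partial>P x)"
    by (rule lim[where w="\<lambda>i. transition_op t (U i)" and w'="transition_op t \<psi>" and r=s,
          OF F' F(2) s measurable_transition_op[OF t seq.hyps(1) aU]
          measurable_transition_op[OF t \<psi> psi_le] abs_transition_op_le[OF t seq.hyps(1) aU] op])
  have eq: "(\<lambda>i. \<integral>\<omega>. F \<omega> * U i (X (s + t) \<omega>) \<partial>P x)
      = (\<lambda>i. \<integral>\<omega>. F \<omega> * transition_op t (U i) (X s \<omega>) \<partial>P x)"
    by (intro ext seq.IH[OF UK])
  show ?case by (rule LIMSEQ_unique[OF lim1[unfolded eq] lim2])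
qed

text \<open>Adding \<open>K\<close> makes \<open>\<psi>\<close> nonnegative, and the constant
  contributes the same term \<open>F * K\<close> on both sides.\<close>

lemma markov_expectation:
  assumes s: "0 \<le> s" and t: "s \<le> t"
    and F: "F \<in> borel_measurable (past s)" "\<And>\<omega>. \<bar>F \<omega>\<bar> \<le> B"
    and \<psi>: "\<psi> \<in> borel_measurable borel" "\<And>y. \<bar>\<psi> y\<bar> \<le> K"
  shows "(\<integral>\<omega>. F \<omega> * \<psi> (X t \<omega>) \<partial>P x)
       = (\<integral>\<omega>. F \<omega> * transition_op (t - s) \<psi> (X s \<omega>) \<partial>P x)"
proof -
  have F': "F \<in> borel_measurable M" by (rule measurable_past_M[OF F(1)])
  have B: "0 \<le> B" using F(2) order_trans[OF abs_ge_zero] by blast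
  have op: "transition_op (t - s) (\<lambda>y. \<psi> y + K) y = transition_op (t - s) \<psi> y + K" for y
  proof -
    interpret prob_space "P y" by (rule prob_law)
    have "integrable (P y) (\<lambda>\<omega>. \<psi> (X (t - s) \<omega>))"
      using t \<psi> by (intro integrable_bounded measurable_comp_X) auto
    then show ?thesis by (simp add: transition_op_def prob_space)
  qed
  have int: "integrable (P x) (\<lambda>\<omega>. F \<omega> * w (X r \<omega>))"
    if "w \<in> borel_measurable borel" "\<And>y. \<bar>w y\<bar> \<le> K" "0 \<le> r" for w r
    using that F F' B
    by (intro integrable_bounded[where B="B * K"] borel_measurable_times measurable_comp_X)
      (auto simp: abs_mult intro!: mult_mono)
  have intF: "integrable (P x) F" using F F' by (intro integrable_bounded)
  have "(\<integral>\<omega>. F \<omega> * (\<psi> (X (s + (t - s)) \<omega>) + K) \<partial>P x)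
       = (\<integral>\<omega>. F \<omega> * transition_op (t - s) (\<lambda>y. \<psi> y + K) (X s \<omega>) \<partial>P x)"
  proof (rule markov_expectation_nonneg[OF s _ F])
    show "0 \<le> \<psi> y + K" "\<psi> y + K \<le> 2 * K" for y using \<psi>(2)[of y] by auto
  qed (use t \<psi> in auto)
  then have "(\<integral>\<omega>. F \<omega> * \<psi> (X t \<omega>) + F \<omega> * K \<partial>P x)
       = (\<integral>\<omega>. F \<omega> * transition_op (t - s) \<psi> (X s \<omega>) + F \<omega> * K \<partial>P x)"
    by (simp add: op distrib_left)
  then show ?thesis
    using s t \<psi> intF int[of \<psi> t] int[of "transition_op (t - s) \<psi>" s]
    by (simp add: measurable_transition_op[where K=K] abs_transition_op_le)
qed

end

section \<open>Shifting one time to the grid\<close>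

lemma prod_list_map_sort:
  fixes g :: "'b::linorder \<Rightarrow> 'c::comm_monoid_mult"
  shows "prod_list (map g (sort xs)) = prod_list (map g xs)"
  by (metis mset_map mset_sort prod_mset_prod_list)

lemma prod_list_map_filter:
  fixes g :: "'b \<Rightarrow> 'c::comm_monoid_mult"
  shows "prod_list (map g xs)
    = prod_list (map g (filter Q xs)) * prod_list (map g (filter (\<lambda>z. \<not> Q z) xs))"
  by (induction xs) (simp_all add: mult.assoc mult.left_commute)

lemma abs_prod_list_le:
  fixes g :: "'b \<Rightarrow> real"
  assumes "\<And>z. z \<in> set xs \<Longrightarrow> \<bar>g z\<bar> \<le> H" "0 \<le> H"
  shows "\<bar>prod_list (map g xs)\<bar> \<le> H ^ length xs"
  using assms(1)
proof (induction xs)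
  case (Cons z xs)
  then show ?case
    using assms(2) unfolding list.map prod_list.Cons abs_mult length_Cons power_Suc
    by (intro mult_mono) simp_all
qed simp

context markov_process
begin

abbreviation path_prod :: "('e \<Rightarrow> real) \<Rightarrow> real list \<Rightarrow> 'w \<Rightarrow> real" where
  "path_prod h ts \<omega> \<equiv> prod_list (map (\<lambda>t. h (X t \<omega>)) ts)"

lemma measurable_path_prod_past:
  assumes "h \<in> borel_measurable borel" "\<And>t. t \<in> set ts \<Longrightarrow> 0 \<le> t \<and> t \<le> r"
  shows "path_prod h ts \<in> borel_measurable (past r)"
  using assms(2)
proof (induction ts)
  case (Cons t ts)
  have "(\<lambda>\<omega>. h (X t \<omega>)) \<in> borel_measurable (past r)"
    using Cons.prems by (intro measurable_compose[OF measurable_X_past assms(1)]) auto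
  with Cons show ?case by simp
qed simp

lemma measurable_path_prod:
  assumes "h \<in> borel_measurable borel" "\<And>t. t \<in> set ts \<Longrightarrow> 0 \<le> t"
  shows "path_prod h ts \<in> borel_measurable M"
  using assms(2)
proof (induction ts)
  case (Cons t ts)
  have "(\<lambda>\<omega>. h (X t \<omega>)) \<in> borel_measurable M"
    using Cons.prems assms(1) by (intro measurable_comp_X) auto
  with Cons show ?case by simp
qed simp

text \<open>The order of quantifiers is the point: one \<open>\<phi>\<close> serves every
  \<open>F\<close> from the past of \<open>b\<close>. Two positions of the shifted time can then be
  compared through the same \<open>\<phi>\<close>, and in the induction the factor at the earliest
  time can be absorbed into \<open>F\<close>.\<close>

lemma future_reduction:
  assumes h: "h \<in> borel_measurable borel" "\<And>y. \<bar>h y\<bar> \<le> H"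
    and f: "f \<in> borel_measurable borel" "\<And>y. \<bar>f y\<bar> \<le> K"
    and "sorted ts" "\<And>t. t \<in> set ts \<Longrightarrow> b \<le> t \<and> t \<le> T" "0 \<le> b" "b \<le> T"
  shows "\<exists>\<phi>\<in>borel_measurable borel. (\<forall>y. \<bar>\<phi> y\<bar> \<le> H ^ length ts * K) \<and>
    (\<forall>F B. F \<in> borel_measurable (past b) \<longrightarrow> (\<forall>\<omega>. \<bar>F \<omega>\<bar> \<le> B) \<longrightarrow>
      (\<integral>\<omega>. F \<omega> * (path_prod h ts \<omega> * f (X T \<omega>)) \<partial>P x) = (\<integral>\<omega>. F \<omega> * \<phi> (X b \<omega>) \<partial>P x))"
  using assms(5-)
proof (induction ts arbitrary: b)
  case Nil
  show ?case
  proof (intro bexI[of _ "transition_op (T - b) f"] conjI allI impI)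
    fix F :: "'w \<Rightarrow> real" and B assume F: "F \<in> borel_measurable (past b)" "\<forall>\<omega>. \<bar>F \<omega>\<bar> \<le> B"
    show "(\<integral>\<omega>. F \<omega> * (path_prod h [] \<omega> * f (X T \<omega>)) \<partial>P x)
        = (\<integral>\<omega>. F \<omega> * transition_op (T - b) f (X b \<omega>) \<partial>P x)"
      using markov_expectation[OF Nil.prems(3,4) F(1) F(2)[rule_format] f, of x] by simp
  qed (use Nil f in \<open>simp_all add: abs_transition_op_le measurable_transition_op[where K=K]\<close>)
next
  case (Cons t ts)
  have t: "b \<le> t" "t \<le> T" "0 \<le> t"
    using Cons.prems(2)[of t] Cons.prems(3) by simp_all
  have H: "0 \<le> H" and K: "0 \<le> K" using order_trans[OF abs_ge_zero] h(2) f(2) by blast+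
  have le: "t \<le> u \<and> u \<le> T" if "u \<in> set ts" for u
    using Cons.prems(1,2) that by auto
  have "sorted ts" using Cons.prems(1) by simp
  from Cons.IH[OF this _ t(3,2)] le obtain \<phi>
    where \<phi>: "\<phi> \<in> borel_measurable borel" "\<forall>y. \<bar>\<phi> y\<bar> \<le> H ^ length ts * K"
    and red: "\<forall>F B. F \<in> borel_measurable (past t) \<longrightarrow> (\<forall>\<omega>. \<bar>F \<omega>\<bar> \<le> B) \<longrightarrow>
      (\<integral>\<omega>. F \<omega> * (path_prod h ts \<omega> * f (X T \<omega>)) \<partial>P x) = (\<integral>\<omega>. F \<omega> * \<phi> (X t \<omega>) \<partial>P x)"
    by (elim meta_impE bexE conjE) assumption
  have h\<phi>: "(\<lambda>y. h y * \<phi> y) \<in> borel_measurable borel" "\<bar>h y * \<phi> y\<bar> \<le> H ^ length (t # ts) * K" for y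
    using h(1) \<phi>(1) mult_mono[OF h(2)[of y] \<phi>(2)[rule_format, of y] H] by (simp_all add: abs_mult)
  show ?case
  proof (intro bexI[of _ "transition_op (t - b) (\<lambda>y. h y * \<phi> y)"] conjI allI impI)
    show "\<bar>transition_op (t - b) (\<lambda>y. h y * \<phi> y) y\<bar> \<le> H ^ length (t # ts) * K" for y
      using t by (intro abs_transition_op_le h\<phi>) simp
    show "transition_op (t - b) (\<lambda>y. h y * \<phi> y) \<in> borel_measurable borel"
      using t by (intro measurable_transition_op[OF _ h\<phi>]) simp
    fix F :: "'w \<Rightarrow> real" and B assume F: "F \<in> borel_measurable (past b)" "\<forall>\<omega>. \<bar>F \<omega>\<bar> \<le> B"
    have hX: "(\<lambda>\<omega>. h (X t \<omega>)) \<in> borel_measurable (past t)"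
      using t by (intro measurable_compose[OF measurable_X_past h(1)]) auto
    have "(\<integral>\<omega>. F \<omega> * (path_prod h (t # ts) \<omega> * f (X T \<omega>)) \<partial>P x)
        = (\<integral>\<omega>. (F \<omega> * h (X t \<omega>)) * (path_prod h ts \<omega> * f (X T \<omega>)) \<partial>P x)"
      by (simp add: mult.assoc)
    also have "\<dots> = (\<integral>\<omega>. (F \<omega> * h (X t \<omega>)) * \<phi> (X t \<omega>) \<partial>P x)"
    proof (rule red[rule_format])
      show "(\<lambda>\<omega>. F \<omega> * h (X t \<omega>)) \<in> borel_measurable (past t)"
        by (intro borel_measurable_times hX measurable_past_mono[OF F(1) t(1)])
      show "\<bar>F \<omega> * h (X t \<omega>)\<bar> \<le> B * H" for \<omega>
        unfolding abs_mult using F(2)[rule_format, of \<omega>] h(2) by (intro mult_mono) auto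
    qed
    also have "\<dots> = (\<integral>\<omega>. F \<omega> * transition_op (t - b) (\<lambda>y. h y * \<phi> y) (X b \<omega>) \<partial>P x)"
      unfolding mult.assoc
      by (rule markov_expectation[OF \<open>0 \<le> b\<close> t(1) F(1) F(2)[rule_format] h\<phi>])
    finally show "(\<integral>\<omega>. F \<omega> * (path_prod h (t # ts) \<omega> * f (X T \<omega>)) \<partial>P x)
        = (\<integral>\<omega>. F \<omega> * transition_op (t - b) (\<lambda>y. h y * \<phi> y) (X b \<omega>) \<partial>P x)" .
  qed
qed

text \<open>All that the later estimates retain of condition X. Uniformity in the starting point
  \<open>y\<close> allows its use inside another transition operator.\<close>

definition log_modulus :: "real \<Rightarrow> real \<Rightarrow> bool" where
  "log_modulus C T \<longleftrightarrow> 1 \<le> C \<and> (\<forall>\<psi> K s t y. \<psi> \<in> borel_measurable borel \<longrightarrow> (\<forall>y. \<bar>\<psi> y\<bar> \<le> K) \<longrightarrow>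
     0 < s \<longrightarrow> s \<le> t \<longrightarrow> t \<le> T \<longrightarrow>
     \<bar>transition_op t \<psi> y - transition_op s \<psi> y\<bar> \<le> C * ln (t / s) * K)"

lemma log_modulusD:
  assumes "log_modulus C T" "\<psi> \<in> borel_measurable borel" "\<And>y. \<bar>\<psi> y\<bar> \<le> K"
    "0 < s" "s \<le> t" "t \<le> T"
  shows "\<bar>transition_op t \<psi> y - transition_op s \<psi> y\<bar> \<le> C * ln (t / s) * K"
  using assms unfolding log_modulus_def by blast

text \<open>With the shifted time at \<open>c\<close>, the expectation is that of \<open>F\<close>
  times \<open>\<Psi> c (X r)\<close>, where \<open>\<Psi> c\<close> runs the semigroup for time
  \<open>c - r\<close>, multiplies by \<open>h\<close>, and has already run it for time
  \<open>b - c\<close>. Moving \<open>c\<close> from \<open>a\<close> to \<open>a'\<close> alters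
  both durations, and each change costs one logarithm.\<close>

lemma time_shift_estimate:
  assumes modulus: "log_modulus C T"
    and h: "h \<in> borel_measurable borel" "\<And>y. \<bar>h y\<bar> \<le> H"
    and f: "f \<in> borel_measurable borel" "\<And>y. \<bar>f y\<bar> \<le> K"
    and times: "0 \<le> r" "r < a'" "a' \<le> a" "a < b" "b \<le> T"
    and ts: "\<And>t. t \<in> set ts \<Longrightarrow> 0 \<le> t \<and> t \<le> r \<or> b \<le> t \<and> t \<le> T"
  shows "\<bar>\<integral>\<omega>. path_prod h ts \<omega> * (h (X a \<omega>) - h (X a' \<omega>)) * f (X T \<omega>) \<partial>P x\<bar>
    \<le> C * H ^ (length ts + 1) * K * (ln ((a - r) / (a' - r)) + ln ((b - a') / (b - a)))"
proof -
  have H: "0 \<le> H" and K: "0 \<le> K" using order_trans[OF abs_ge_zero] h(2) f(2) by blast+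
  have C: "0 \<le> C" using modulus by (simp add: log_modulus_def)
  have ts0: "0 \<le> t" if "t \<in> set ts" for t using ts[OF that] times by auto
  define pre where "pre = filter (\<lambda>t. t \<le> r) ts"
  \<comment> \<open>Only the later times need an order, as they are integrated out one by one; the
    earlier ones merely form a factor measurable with respect to the past of
    \<open>r\<close>.\<close>
  define post where "post = sort (filter (\<lambda>t. \<not> t \<le> r) ts)"
  define F where "F = path_prod h pre"
  have prod: "path_prod h ts \<omega> = F \<omega> * path_prod h post \<omega>" for \<omega>
    unfolding F_def pre_def post_def prod_list_map_sort by (rule prod_list_map_filter)
  have len: "length pre + length post = length ts"
    unfolding pre_def post_def by (simp add: sum_length_filter_compl)
  have F: "F \<in> borel_measurable (past r)" "\<And>\<omega>. \<bar>F \<omega>\<bar> \<le> H ^ length pre"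
    unfolding F_def using ts0
    by (auto simp: pre_def intro!: measurable_path_prod_past h abs_prod_list_le H)
  have "\<exists>\<phi>\<in>borel_measurable borel. (\<forall>y. \<bar>\<phi> y\<bar> \<le> H ^ length post * K) \<and>
    (\<forall>F B. F \<in> borel_measurable (past b) \<longrightarrow> (\<forall>\<omega>. \<bar>F \<omega>\<bar> \<le> B) \<longrightarrow>
      (\<integral>\<omega>. F \<omega> * (path_prod h post \<omega> * f (X T \<omega>)) \<partial>P x) = (\<integral>\<omega>. F \<omega> * \<phi> (X b \<omega>) \<partial>P x))"
    by (rule future_reduction[OF h f]) (use ts times in \<open>auto simp: post_def\<close>)
  then obtain \<phi>
    where \<phi>: "\<phi> \<in> borel_measurable borel" "\<forall>y. \<bar>\<phi> y\<bar> \<le> H ^ length post * K"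
    and red: "\<forall>F B. F \<in> borel_measurable (past b) \<longrightarrow> (\<forall>\<omega>. \<bar>F \<omega>\<bar> \<le> B) \<longrightarrow>
      (\<integral>\<omega>. F \<omega> * (path_prod h post \<omega> * f (X T \<omega>)) \<partial>P x) = (\<integral>\<omega>. F \<omega> * \<phi> (X b \<omega>) \<partial>P x)"
    by (elim bexE conjE)
  note \<phi> = \<phi>(1) \<phi>(2)[rule_format] and red = red[rule_format]
  let ?L = "H ^ length post * K"
  define \<psi> where "\<psi> c = (\<lambda>y. h y * transition_op (b - c) \<phi> y)" for c
  have L: "0 \<le> ?L" using H K by simp
  have \<psi>: "\<psi> c \<in> borel_measurable borel" "\<bar>\<psi> c y\<bar> \<le> H * ?L" if "c \<le> b" for c y
    unfolding \<psi>_def abs_mult using that h H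
    by (auto intro!: borel_measurable_times mult_mono abs_transition_op_le \<phi>
        measurable_transition_op[OF _ \<phi>])
  define \<Psi> where "\<Psi> c = transition_op (c - r) (\<psi> c)" for c
  have \<Psi>: "\<Psi> c \<in> borel_measurable borel" "\<bar>\<Psi> c y\<bar> \<le> H * ?L" if "r \<le> c" "c \<le> b" for c y
    unfolding \<Psi>_def using that \<psi>[of c]
    by (auto intro!: abs_transition_op_le measurable_transition_op)
  \<comment> \<open>Reduction from the latest time backwards: to \<open>b\<close>, then to
    \<open>c\<close>, then to \<open>r\<close>.\<close>
  have shifted: "(\<integral>\<omega>. path_prod h ts \<omega> * h (X c \<omega>) * f (X T \<omega>) \<partial>P x) = (\<integral>\<omega>. F \<omega> * \<Psi> c (X r \<omega>) \<partial>P x)"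
    if "r \<le> c" "c \<le> b" for c
  proof -
    have hX: "(\<lambda>\<omega>. h (X c \<omega>)) \<in> borel_measurable (past c)"
      using that times by (intro measurable_compose[OF measurable_X_past h(1)]) auto
    have Fh: "(\<lambda>\<omega>. F \<omega> * h (X c \<omega>)) \<in> borel_measurable (past c)"
      by (intro borel_measurable_times hX measurable_past_mono[OF F(1) that(1)])
    have Fhb: "\<bar>F \<omega> * h (X c \<omega>)\<bar> \<le> H ^ length pre * H" for \<omega>
      unfolding abs_mult using F(2) h(2) H by (intro mult_mono) auto
    have "(\<integral>\<omega>. path_prod h ts \<omega> * h (X c \<omega>) * f (X T \<omega>) \<partial>P x)
        = (\<integral>\<omega>. (F \<omega> * h (X c \<omega>)) * (path_prod h post \<omega> * f (X T \<omega>)) \<partial>P x)"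
      by (simp add: prod ac_simps)
    also have "\<dots> = (\<integral>\<omega>. (F \<omega> * h (X c \<omega>)) * \<phi> (X b \<omega>) \<partial>P x)"
      by (rule red[OF measurable_past_mono[OF Fh that(2)] Fhb])
    also have "\<dots> = (\<integral>\<omega>. (F \<omega> * h (X c \<omega>)) * transition_op (b - c) \<phi> (X c \<omega>) \<partial>P x)"
      using that times by (intro markov_expectation[OF _ _ Fh Fhb \<phi>]) auto
    also have "\<dots> = (\<integral>\<omega>. F \<omega> * \<psi> c (X c \<omega>) \<partial>P x)"
      by (simp add: \<psi>_def mult.assoc)
    also have "\<dots> = (\<integral>\<omega>. F \<omega> * \<Psi> c (X r \<omega>) \<partial>P x)"
      unfolding \<Psi>_def by (rule markov_expectation[OF times(1) that(1) F \<psi>[OF that(2)]])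
    finally show ?thesis .
  qed
  have int: "integrable (P x) (\<lambda>\<omega>. path_prod h ts \<omega> * h (X c \<omega>) * f (X T \<omega>))" if "0 \<le> c" for c
  proof (rule integrable_bounded)
    show "(\<lambda>\<omega>. path_prod h ts \<omega> * h (X c \<omega>) * f (X T \<omega>)) \<in> borel_measurable M"
      using that times ts0
      by (intro borel_measurable_times measurable_path_prod measurable_comp_X h f) auto
    show "\<bar>path_prod h ts \<omega> * h (X c \<omega>) * f (X T \<omega>)\<bar> \<le> H ^ length ts * H * K" for \<omega>
      unfolding abs_mult using H K h f by (intro mult_mono abs_prod_list_le) auto
  qed
  have intF: "integrable (P x) (\<lambda>\<omega>. F \<omega> * \<Psi> c (X r \<omega>))" if "r \<le> c" "c \<le> b" for c
  proof (rule integrable_bounded)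
    show "(\<lambda>\<omega>. F \<omega> * \<Psi> c (X r \<omega>)) \<in> borel_measurable M"
      by (intro borel_measurable_times measurable_past_M[OF F(1)] measurable_comp_X \<Psi> that times)
    show "\<bar>F \<omega> * \<Psi> c (X r \<omega>)\<bar> \<le> H ^ length pre * (H * ?L)" for \<omega>
      unfolding abs_mult using F(2) \<Psi>(2)[OF that] H by (intro mult_mono) auto
  qed
  have "(\<integral>\<omega>. path_prod h ts \<omega> * (h (X a \<omega>) - h (X a' \<omega>)) * f (X T \<omega>) \<partial>P x)
      = (\<integral>\<omega>. path_prod h ts \<omega> * h (X a \<omega>) * f (X T \<omega>) \<partial>P x)
        - (\<integral>\<omega>. path_prod h ts \<omega> * h (X a' \<omega>) * f (X T \<omega>) \<partial>P x)"
    using int[of a] int[of a'] times by (simp add: left_diff_distrib right_diff_distrib)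
  also have "\<dots> = (\<integral>\<omega>. F \<omega> * (\<Psi> a (X r \<omega>) - \<Psi> a' (X r \<omega>)) \<partial>P x)"
    using shifted[of a] shifted[of a'] intF[of a] intF[of a'] times by (simp add: right_diff_distrib)
  finally have eq: "(\<integral>\<omega>. path_prod h ts \<omega> * (h (X a \<omega>) - h (X a' \<omega>)) * f (X T \<omega>) \<partial>P x)
      = (\<integral>\<omega>. F \<omega> * (\<Psi> a (X r \<omega>) - \<Psi> a' (X r \<omega>)) \<partial>P x)" .
  let ?D = "C * (H * ?L) * (ln ((a - r) / (a' - r)) + ln ((b - a') / (b - a)))"
  \<comment> \<open>The outer duration changes first, with \<open>\<psi> a\<close> kept; then the
    inner one, where the outer operator only has to be a contraction in the sup-norm.\<close>
  have \<Psi>_diff: "\<bar>\<Psi> a y - \<Psi> a' y\<bar> \<le> ?D" for y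
  proof -
    have "\<bar>transition_op (a - r) (\<psi> a) y - transition_op (a' - r) (\<psi> a) y\<bar>
        \<le> C * ln ((a - r) / (a' - r)) * (H * ?L)"
      using times by (intro log_modulusD[OF modulus] \<psi>) auto
    moreover have "\<bar>transition_op (a' - r) (\<lambda>z. \<psi> a z - \<psi> a' z) y\<bar>
        \<le> H * (C * ln ((b - a') / (b - a)) * ?L)"
    proof (rule abs_transition_op_le)
      fix z
      have "\<bar>transition_op (b - a') \<phi> z - transition_op (b - a) \<phi> z\<bar> \<le> C * ln ((b - a') / (b - a)) * ?L"
        using times by (intro log_modulusD[OF modulus] \<phi>) auto
      then have "\<bar>h z\<bar> * \<bar>transition_op (b - a) \<phi> z - transition_op (b - a') \<phi> z\<bar>
          \<le> H * (C * ln ((b - a') / (b - a)) * ?L)"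
        using h(2) H by (intro mult_mono) (auto simp: abs_minus_commute)
      then show "\<bar>\<psi> a z - \<psi> a' z\<bar> \<le> H * (C * ln ((b - a') / (b - a)) * ?L)"
        by (simp add: \<psi>_def abs_mult[symmetric] right_diff_distrib)
    qed (use times \<psi>(1)[of a] \<psi>(1)[of a'] in auto)
    moreover have "transition_op (a' - r) (\<lambda>z. \<psi> a z - \<psi> a' z) y
        = transition_op (a' - r) (\<psi> a) y - transition_op (a' - r) (\<psi> a') y"
      using times by (intro transition_op_diff[where K="H * ?L" and L="H * ?L"] \<psi>) auto
    ultimately have "\<bar>\<Psi> a y - \<Psi> a' y\<bar> \<le> C * ln ((a - r) / (a' - r)) * (H * ?L)
        + H * (C * ln ((b - a') / (b - a)) * ?L)"
      unfolding \<Psi>_def by linarith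
    then show ?thesis by (simp add: algebra_simps)
  qed
  have "\<bar>\<integral>\<omega>. F \<omega> * (\<Psi> a (X r \<omega>) - \<Psi> a' (X r \<omega>)) \<partial>P x\<bar> \<le> H ^ length pre * ?D"
  proof (rule abs_expectation_le)
    show "(\<lambda>\<omega>. F \<omega> * (\<Psi> a (X r \<omega>) - \<Psi> a' (X r \<omega>))) \<in> borel_measurable M"
      using times
      by (intro borel_measurable_times borel_measurable_diff measurable_past_M[OF F(1)] measurable_comp_X \<Psi>) auto
    show "\<bar>F \<omega> * (\<Psi> a (X r \<omega>) - \<Psi> a' (X r \<omega>))\<bar> \<le> H ^ length pre * ?D" for \<omega>
      unfolding abs_mult using F(2) \<Psi>_diff H by (intro mult_mono) auto
  qed
  also have "H ^ length pre * ?D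
      = C * H ^ (length ts + 1) * K * (ln ((a - r) / (a' - r)) + ln ((b - a') / (b - a)))"
    unfolding len[symmetric] by (simp add: power_add)
  finally show ?thesis unfolding eq .
qed

end

text \<open>Dominates the two nearest cells by the sum over all of them; distinct values guarantee
  two different list entries.\<close>

lemma two_members_le_sum_list:
  fixes W :: "'b \<Rightarrow> real"
  assumes "c \<in> set L" "d \<in> set L" "c \<noteq> d" "\<And>x. x \<in> set L \<Longrightarrow> 0 \<le> W x"
  shows "W c + W d \<le> sum_list (map W L)"
proof -
  have nonneg: "0 \<le> sum_list (map W xs)" if "set xs \<subseteq> set L" for xs
    using that assms(4) by (intro sum_list_nonneg) auto
  have d: "d \<in> set (remove1 c L)" using assms(2,3) by simp
  have "set (remove1 d (remove1 c L)) \<subseteq> set L"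
    by (meson set_remove1_subset subset_trans)
  then show ?thesis
    using nonneg[of "remove1 d (remove1 c L)"]
    by (simp add: sum_list_map_remove1[OF assms(1)] sum_list_map_remove1[OF d])
qed

context markov_process
begin

text \<open>
  In the nontrivial case the Markov property is applied at the grid points \<open>r\<close> and \<open>b\<close> that separate
  the cell of \<open>s\<close> from the nearest earlier and later cells containing some \<open>t\<^sub>i\<close>.
\<close>

lemma cell_estimate:
  assumes modulus: "log_modulus C T"
    and h: "h \<in> borel_measurable borel" "\<And>y. \<bar>h y\<bar> \<le> H"
    and f: "f \<in> borel_measurable borel" "\<And>y. \<bar>f y\<bar> \<le> K"
    and T: "0 < T" and m: "m < n" and \<delta>: "\<delta> = T / real n" and u: "0 < u" "u < \<delta>"
    and ts: "\<And>t. t \<in> set ts \<Longrightarrow> 0 \<le> t \<and> t < T"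
  shows "\<bar>\<integral>\<omega>. path_prod h ts \<omega> * (h (X (real m * \<delta> + u) \<omega>) - h (X (real m * \<delta>) \<omega>)) * f (X T \<omega>) \<partial>P x\<bar>
    \<le> C * H ^ (length ts + 1) * K *
        sum_list (map (\<lambda>c. cell_weight \<delta> (c - int m) u) (-1 # int n # map (\<lambda>t. \<lfloor>t / \<delta>\<rfloor>) ts))"
    (is "\<bar>?E\<bar> \<le> ?A * sum_list (map ?W ?L)")
proof -
  have H: "0 \<le> H" and K: "0 \<le> K" using order_trans[OF abs_ge_zero] h(2) f(2) by blast+
  have C: "1 \<le> C" using modulus by (simp add: log_modulus_def)
  have \<delta>_pos: "0 < \<delta>" using T m \<delta> by simp
  have T_eq: "T = real n * \<delta>" using m \<delta> by simp
  have W: "0 \<le> ?W c" for c by (rule cell_weight_nonneg[OF u])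
  have A: "0 \<le> ?A" using C H K by simp
  show ?thesis
  proof (cases "\<exists>c\<in>set ?L. c = int m \<or> c = int m - 1")
    \<comment> \<open>For \<open>m = 0\<close> the entry \<open>-1\<close>, which stands for the
      starting time, always leads to this case.\<close>
    case True
    then obtain c where c: "c \<in> set ?L" "c = int m \<or> c = int m - 1" by blast
    have "\<bar>?E\<bar> \<le> H ^ length ts * (H + H) * K"
    proof (rule abs_expectation_le)
      show "(\<lambda>\<omega>. path_prod h ts \<omega> * (h (X (real m * \<delta> + u) \<omega>) - h (X (real m * \<delta>) \<omega>)) * f (X T \<omega>))
          \<in> borel_measurable M"
        using ts u \<delta>_pos T
        by (intro borel_measurable_times borel_measurable_diff measurable_path_prod measurable_comp_X h f) auto
      show "\<bar>path_prod h ts \<omega> * (h (X (real m * \<delta> + u) \<omega>) - h (X (real m * \<delta>) \<omega>)) * f (X T \<omega>)\<bar>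
          \<le> H ^ length ts * (H + H) * K" for \<omega>
        unfolding abs_mult
        by (intro mult_mono abs_prod_list_le h f H order_trans[OF abs_triangle_ineq4] add_mono) (use H K in auto)
    qed
    \<comment> \<open>Here \<open>1 \<le> C\<close> enters: the trivial bound has no factor
      \<open>C\<close> of its own.\<close>
    also have "\<dots> = (1 * H ^ (length ts + 1) * K) * 2" by simp
    also have "\<dots> \<le> ?A * 2" using C H K by (intro mult_right_mono) auto
    also have "?A * 2 \<le> ?A * sum_list (map ?W ?L)"
    proof -
      have "?W c = 2" using c(2) by (auto simp: cell_weight_def)
      moreover have "?W c \<le> sum_list (map ?W ?L)"
        using W c(1) by (intro member_le_sum_list) (auto simp only: set_map)
      ultimately show ?thesis by (intro mult_left_mono A) simp
    qed
    finally show ?thesis .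
  next
    case False
    have L: "c \<le> int m - 2 \<or> int m + 1 \<le> c" if "c \<in> set ?L" for c
    proof -
      have "c \<noteq> int m" "c \<noteq> int m - 1" using False that by blast+
      then show ?thesis by presburger
    qed
    \<comment> \<open>The entries \<open>-1\<close> and \<open>int n\<close>, standing for the times
      \<open>0\<close> and \<open>T\<close>, keep both sets nonempty.\<close>
    define l where "l = Max {c \<in> set ?L. c \<le> int m - 2}"
    define r where "r = Min {c \<in> set ?L. int m + 1 \<le> c}"
    have "-1 \<le> int m - 2" using L[of "-1"] by simp
    then have l_ne: "-1 \<in> {c \<in> set ?L. c \<le> int m - 2}" by simp
    have r_ne: "int n \<in> {c \<in> set ?L. int m + 1 \<le> c}" using m by simp
    have l: "l \<in> set ?L" "l \<le> int m - 2" using Max_in[of "{c \<in> set ?L. c \<le> int m - 2}"] l_ne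
      unfolding l_def by (blast intro: finite_subset[OF _ finite_set[of ?L]])+
    have r: "r \<in> set ?L" "int m + 1 \<le> r" using Min_in[of "{c \<in> set ?L. int m + 1 \<le> c}"] r_ne
      unfolding r_def by (blast intro: finite_subset[OF _ finite_set[of ?L]])+
    have l_max: "c \<le> l" if "c \<in> set ?L" "c \<le> int m - 2" for c
      unfolding l_def using that by (intro Max_ge) auto
    have r_min: "r \<le> c" if "c \<in> set ?L" "int m + 1 \<le> c" for c
      unfolding r_def using that by (intro Min_le) auto
    have l_ge: "-1 \<le> l" using l_max l_ne by blast
    have r_le: "r \<le> int n" using r_min r_ne by blast
    let ?l = "(of_int l + 1) * \<delta>" and ?r = "of_int r * \<delta>"
    have mono: "of_int i * \<delta> \<le> of_int k * \<delta>" if "i \<le> k" for i k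
      using that \<delta>_pos by (intro mult_right_mono) auto
    have "\<bar>?E\<bar> \<le> ?A * (ln ((real m * \<delta> + u - ?l) / (real m * \<delta> - ?l))
        + ln ((?r - real m * \<delta>) / (?r - (real m * \<delta> + u))))"
    proof (rule time_shift_estimate[OF modulus h f])
      show "0 \<le> ?l" using l_ge \<delta>_pos by simp
      show "?l < real m * \<delta>" using mono[of "l + 1" "int m - 1"] l(2) \<delta>_pos by (simp add: algebra_simps)
      show "real m * \<delta> + u < ?r" using mono[OF r(2)] u by (simp add: algebra_simps)
      show "?r \<le> T" using mono[OF r_le] T_eq by simp
      fix t assume t: "t \<in> set ts"
      then have c: "\<lfloor>t / \<delta>\<rfloor> \<in> set ?L" by simp
      have "of_int \<lfloor>t / \<delta>\<rfloor> \<le> t / \<delta>" "t / \<delta> < of_int \<lfloor>t / \<delta>\<rfloor> + 1" by linarith+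
      then have floor: "of_int \<lfloor>t / \<delta>\<rfloor> * \<delta> \<le> t" "t < of_int (\<lfloor>t / \<delta>\<rfloor> + 1) * \<delta>"
        by (simp_all only: pos_le_divide_eq[OF \<delta>_pos] pos_divide_less_eq[OF \<delta>_pos] of_int_add of_int_1)
      from L[OF c] show "0 \<le> t \<and> t \<le> ?l \<or> ?r \<le> t \<and> t \<le> T"
      proof
        assume "\<lfloor>t / \<delta>\<rfloor> \<le> int m - 2"
        then have "t \<le> ?l" using l_max[OF c] floor(2) mono[of "\<lfloor>t / \<delta>\<rfloor> + 1" "l + 1"] by simp
        then show ?thesis using ts[OF t] by simp
      next
        assume "int m + 1 \<le> \<lfloor>t / \<delta>\<rfloor>"
        then have "?r \<le> t" using r_min[OF c] floor(1) mono[of r "\<lfloor>t / \<delta>\<rfloor>"] by simp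
        then show ?thesis using ts[OF t] by simp
      qed
    qed (use u in auto)
    also have "ln ((real m * \<delta> + u - ?l) / (real m * \<delta> - ?l)) = ?W l"
      using l(2) by (simp add: cell_weight_def algebra_simps)
    also have "ln ((?r - real m * \<delta>) / (?r - (real m * \<delta> + u))) = ?W r"
      using r(2) by (simp add: cell_weight_def algebra_simps)
    also have "?A * (?W l + ?W r) \<le> ?A * sum_list (map ?W ?L)"
      using l r W by (intro mult_left_mono A two_members_le_sum_list) auto
    finally show ?thesis .
  qed
qed

end

section \<open>Moments of the integral functional\<close>

lemma set_integral_shift:
  fixes \<psi> :: "real \<Rightarrow> real"
  shows "(LINT t:{a<..<a + \<delta>}|lborel. \<psi> t) = (LINT u:{0<..<\<delta>}|lborel. \<psi> (a + u))"
proof -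
  have "(LINT t:{a<..<a + \<delta>}|lborel. \<psi> t)
      = (\<integral>u. indicator {a<..<a + \<delta>} (a + 1 * u) *\<^sub>R \<psi> (a + 1 * u) \<partial>lborel)"
    unfolding set_lebesgue_integral_def by (subst lborel_integral_real_affine[where c=1 and t=a]) simp_all
  also have "\<dots> = (LINT u:{0<..<\<delta>}|lborel. \<psi> (a + u))"
    unfolding set_lebesgue_integral_def by (intro Bochner_Integration.integral_cong) (auto simp: indicator_def)
  finally show ?thesis .
qed

lemma set_integral_Ico_eq_Icc:
  fixes \<psi> :: "real \<Rightarrow> real"
  assumes "a \<le> b"
  shows "(LINT t:{a..<b}|lborel. \<psi> t) = (LINT t:{a..b}|lborel. \<psi> t)"
  using assms by (simp add: interval_integral_Ico[symmetric] interval_integral_Icc[symmetric])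

text \<open>Open cells, because the weights are controlled only for \<open>0 < u < \<delta>\<close>;
  the grid points form a null set.\<close>

lemma set_integral_cells:
  fixes \<psi> :: "real \<Rightarrow> real"
  assumes \<delta>: "0 \<le> \<delta>" and "set_integrable lborel {0..real n * \<delta>} \<psi>"
  shows "(LINT t:{0..real n * \<delta>}|lborel. \<psi> t)
    = (\<Sum>m<n. LINT u:{0<..<\<delta>}|lborel. \<psi> (real m * \<delta> + u))"
  using assms(2)
proof (induction n)
  case 0
  have "(LINT t:{0..0::real}|lborel. \<psi> t) = (LINT t:{0..<0::real}|lborel. \<psi> t)"
    by (rule set_integral_Ico_eq_Icc[symmetric]) simp
  then show ?case by (simp add: set_lebesgue_integral_def)
next
  case (Suc n)
  let ?a = "real n * \<delta>"
  have le: "0 \<le> ?a" "?a \<le> ?a + \<delta>" using \<delta> by simp_all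
  have S: "real (Suc n) * \<delta> = ?a + \<delta>" by (simp add: algebra_simps)
  have sub: "set_integrable lborel A \<psi>" if "A \<in> sets borel" "A \<subseteq> {0..?a + \<delta>}" for A
    using set_integrable_subset[OF Suc.prems] that S by simp
  have "interval_lebesgue_integrable lborel (ereal 0) (ereal (?a + \<delta>)) \<psi>"
    using le by (auto simp: interval_lebesgue_integrable_def intro!: sub)
  then have "(LBINT t=ereal 0..ereal ?a. \<psi> t) + (LBINT t=ereal ?a..ereal (?a + \<delta>). \<psi> t)
      = (LBINT t=ereal 0..ereal (?a + \<delta>). \<psi> t)"
    using le by (intro interval_integral_sum) (simp add: min_def max_def)
  moreover have "(LBINT t=ereal 0..ereal (?a + \<delta>). \<psi> t) = (LINT t:{0..?a + \<delta>}|lborel. \<psi> t)"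
    using le by (intro interval_integral_Icc) simp
  moreover have "(LBINT t=ereal 0..ereal ?a. \<psi> t) = (LINT t:{0..?a}|lborel. \<psi> t)"
    using le by (intro interval_integral_Icc) simp
  moreover have "(LBINT t=ereal ?a..ereal (?a + \<delta>). \<psi> t) = (LINT t:{?a<..<?a + \<delta>}|lborel. \<psi> t)"
    using le by (simp add: interval_integral_Ioo)
  ultimately have "(LINT t:{0..?a + \<delta>}|lborel. \<psi> t)
      = (LINT t:{0..?a}|lborel. \<psi> t) + (LINT t:{?a<..<?a + \<delta>}|lborel. \<psi> t)"
    by simp
  with Suc.IH[OF sub] show ?case using le unfolding S by (simp add: set_integral_shift)
qed

lemma set_integral_restrict_space:
  fixes \<psi> :: "real \<Rightarrow> real"
  assumes "A \<in> sets borel"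
  shows "(LINT t:A|lborel. \<psi> t) = (\<integral>t. \<psi> t \<partial>restrict_space lborel A)"
  using assms by (simp add: set_lebesgue_integral_def integral_restrict_space)

lemma abs_mult_le: "\<bar>a\<bar> \<le> A \<Longrightarrow> \<bar>b\<bar> \<le> B \<Longrightarrow> \<bar>a * b\<bar> \<le> A * (B :: real)"
  unfolding abs_mult by (intro mult_mono) auto

lemma abs_power_le: "\<bar>a\<bar> \<le> A \<Longrightarrow> \<bar>a ^ m\<bar> \<le> (A :: real) ^ m"
  unfolding power_abs by (intro power_mono) auto

lemma finite_measure_restrict_lborel:
  fixes A :: "real set"
  assumes "A \<in> sets borel" "A \<subseteq> {a..b}"
  shows "finite_measure (restrict_space lborel A)"
proof
  have "emeasure lborel A \<le> emeasure lborel {a..b}"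
    using assms by (intro emeasure_mono) auto
  also have "\<dots> < \<infinity>" by (cases "a \<le> b") auto
  finally show "emeasure (restrict_space lborel A) (space (restrict_space lborel A)) \<noteq> \<infinity>"
    using assms by (simp add: emeasure_restrict_space space_restrict_space)
qed

context markov_process
begin

text \<open>Joint measurability of the process is given for nonnegative times only, so time
  integrals use restricted Lebesgue measure and the shifted time \<open>a + t\<close> must stay in
  the half-line.\<close>

lemma measurable_path_restrict:
  fixes h :: "'e \<Rightarrow> real"
  assumes h: "h \<in> borel_measurable borel" and A: "A \<subseteq> {0..}" "0 \<le> a"
  shows "(\<lambda>(t, \<omega>). h (X (a + t) \<omega>)) \<in> borel_measurable (restrict_space lborel A \<Otimes>\<^sub>M M)"
proof -
  have "(\<lambda>z. (a + fst z, snd z)) \<in> restrict_space lborel A \<Otimes>\<^sub>M M \<rightarrow>\<^sub>M restrict_space borel {0..} \<Otimes>\<^sub>M M"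
  proof (intro measurable_Pair measurable_restrict_space2)
    have "fst \<in> restrict_space lborel A \<Otimes>\<^sub>M M \<rightarrow>\<^sub>M (borel :: real measure)"
      by (intro measurable_compose[OF measurable_fst] measurable_restrict_space1) simp
    then show "(\<lambda>z. a + fst z) \<in> restrict_space lborel A \<Otimes>\<^sub>M M \<rightarrow>\<^sub>M borel"
      by simp
  qed (use A in \<open>auto simp: space_pair_measure space_restrict_space\<close>)
  from measurable_compose[OF measurable_compose[OF this measurable_process] h]
  show ?thesis by (simp add: case_prod_beta')
qed

lemma expectation_Fubini:
  fixes \<psi> :: "'b \<Rightarrow> 'w \<Rightarrow> real"
  assumes \<nu>: "finite_measure \<nu>"
    and \<psi>: "case_prod \<psi> \<in> borel_measurable (\<nu> \<Otimes>\<^sub>M M)"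
    and B: "\<And>t \<omega>. \<bar>\<psi> t \<omega>\<bar> \<le> B"
  shows "(\<integral>\<omega>. (\<integral>t. \<psi> t \<omega> \<partial>\<nu>) \<partial>P x) = (\<integral>t. (\<integral>\<omega>. \<psi> t \<omega> \<partial>P x) \<partial>\<nu>)"
    and "integrable \<nu> (\<lambda>t. \<integral>\<omega>. \<psi> t \<omega> \<partial>P x)"
    and "(\<lambda>\<omega>. \<integral>t. \<psi> t \<omega> \<partial>\<nu>) \<in> borel_measurable M"
proof -
  interpret P: prob_space "P x" by (rule prob_law)
  interpret \<nu>: finite_measure \<nu> by (rule \<nu>)
  interpret pair_sigma_finite \<nu> "P x" by unfold_locales
  interpret finite_measure "\<nu> \<Otimes>\<^sub>M P x"
    by (rule finite_measure_pair_measure) unfold_locales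
  have sets: "sets (\<nu> \<Otimes>\<^sub>M P x) = sets (\<nu> \<Otimes>\<^sub>M M)"
    by (intro sets_pair_measure_cong sets_law refl)
  have int: "integrable (\<nu> \<Otimes>\<^sub>M P x) (case_prod \<psi>)"
    using \<psi> B by (intro integrable_const_bound[of _ B]) (auto simp: measurable_cong_sets[OF sets refl])
  show "(\<integral>\<omega>. (\<integral>t. \<psi> t \<omega> \<partial>\<nu>) \<partial>P x) = (\<integral>t. (\<integral>\<omega>. \<psi> t \<omega> \<partial>P x) \<partial>\<nu>)"
    by (rule Fubini_integral[OF int])
  show "integrable \<nu> (\<lambda>t. \<integral>\<omega>. \<psi> t \<omega> \<partial>P x)"
    using integrable_fst[OF int] by simp
  have "case_prod (\<lambda>\<omega> t. \<psi> t \<omega>) \<in> borel_measurable (M \<Otimes>\<^sub>M \<nu>)"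
    using measurable_compose[OF measurable_pair_swap' \<psi>] by (simp add: case_prod_beta')
  then show "(\<lambda>\<omega>. \<integral>t. \<psi> t \<omega> \<partial>\<nu>) \<in> borel_measurable M"
    by (rule \<nu>.borel_measurable_lebesgue_integral)
qed

section \<open>Moments of the functional against those of its integral sum\<close>

context
  fixes C T H K :: real and h f :: "'e \<Rightarrow> real" and n :: nat and \<delta> :: real
  assumes modulus: "log_modulus C T"
    and T: "0 < T" and n: "2 \<le> n" and \<delta>: "\<delta> = T / real n"
    and h: "h \<in> borel_measurable borel" "\<And>y. \<bar>h y\<bar> \<le> H"
    and f: "f \<in> borel_measurable borel" "\<And>y. \<bar>f y\<bar> \<le> K"
begin

private lemma H_nonneg: "0 \<le> H" and K_nonneg: "0 \<le> K" and C_nonneg: "0 \<le> C"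
  and \<delta>_pos: "0 < \<delta>" and T_eq: "T = real n * \<delta>"
  using order_trans[OF abs_ge_zero h(2)] order_trans[OF abs_ge_zero f(2)] modulus T n \<delta>
  by (auto simp: log_modulus_def)

private abbreviation "I \<equiv> integral_functional X T h"
private abbreviation "J \<equiv> integral_sum X T n h"

private lemma J_eq: "J \<omega> = \<delta> * (\<Sum>j<n. h (X (real j * \<delta>) \<omega>))"
  by (simp add: integral_sum_def \<delta>)

private lemma set_integrable_path:
  assumes "\<omega> \<in> space M" "0 \<le> a" "A \<in> sets borel" "A \<subseteq> {0..b}"
  shows "integrable (restrict_space lborel A) (\<lambda>t. h (X (a + t) \<omega>))"
proof -
  interpret finite_measure "restrict_space lborel A"
    by (rule finite_measure_restrict_lborel[OF assms(3,4)])
  have "A \<subseteq> {0..}" using assms(4) by auto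
  from measurable_compose[OF measurable_Pair2'[OF assms(1)] measurable_path_restrict[OF h(1) this assms(2)]]
  have "(\<lambda>t. h (X (a + t) \<omega>)) \<in> borel_measurable (restrict_space lborel A)" by simp
  then show ?thesis using h(2) by (intro integrable_const_bound[of _ H]) auto
qed

text \<open>The half-open interval places every time in one of the cells \<open>0\<close> to
  \<open>n - 1\<close>; the endpoint \<open>T\<close> itself would fall into cell
  \<open>n\<close>.\<close>

private lemma I_eq: "I \<omega> = (\<integral>t. h (X t \<omega>) \<partial>restrict_space lborel {0..<T})"
  unfolding integral_functional_def set_integral_Ico_eq_Icc[OF less_imp_le[OF T], symmetric]
  by (rule set_integral_restrict_space) simp

lemma integral_functional_measurable: "I \<in> borel_measurable M"
proof -
  have Ico_subset: "{0..<b} \<subseteq> {0..}" for b :: real by auto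
  have "finite_measure (restrict_space lborel {0..<T})"
    by (rule finite_measure_restrict_lborel[where a=0 and b=T]) auto
  from expectation_Fubini(3)[OF this, of "\<lambda>t \<omega>. h (X t \<omega>)" H]
  show ?thesis
    using measurable_path_restrict[OF h(1) Ico_subset order_refl, of T] h(2) by (simp add: I_eq[abs_def])
qed

lemma integral_sum_measurable: "J \<in> borel_measurable M"
  unfolding J_eq[abs_def] using \<delta>_pos
  by (intro borel_measurable_times borel_measurable_sum measurable_comp_X h) auto

lemma abs_integral_functional_le: "\<bar>I \<omega>\<bar> \<le> T * H"
proof -
  have "\<bar>I \<omega>\<bar> \<le> (\<integral>t. H \<partial>restrict_space lborel {0..<T})"
  proof (cases "integrable (restrict_space lborel {0..<T}) (\<lambda>t. h (X t \<omega>))")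
    case True
    interpret finite_measure "restrict_space lborel {0..<T}"
      by (rule finite_measure_restrict_lborel[where a=0 and b=T]) auto
    show ?thesis unfolding I_eq
      using Bochner_Integration.integral_norm_bound_integral[OF True, of "\<lambda>_. H"] h(2) by simp
  next
    \<comment> \<open>Outside \<open>space M\<close> a path need not be integrable; the integral
      then has the default value \<open>0\<close>, so the bound holds for every
      \<open>\<omega>\<close>.\<close>
    case False
    then show ?thesis unfolding I_eq using H_nonneg by (simp add: not_integrable_integral_eq)
  qed
  also have "\<dots> = T * H"
    using T by (simp add: measure_restrict_space space_restrict_space)
  finally show ?thesis .
qed

lemma abs_integral_sum_le: "\<bar>J \<omega>\<bar> \<le> T * H"
proof -
  have "\<bar>\<Sum>j<n. h (X (real j * \<delta>) \<omega>)\<bar> \<le> (\<Sum>j<n. H)"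
    by (rule order_trans[OF sum_abs sum_mono]) (rule h(2))
  then have "\<delta> * \<bar>\<Sum>j<n. h (X (real j * \<delta>) \<omega>)\<bar> \<le> \<delta> * (\<Sum>j<n. H)"
    using \<delta>_pos by (intro mult_left_mono) auto
  moreover have "\<delta> * (\<Sum>j<n. H) = T * H" by (subst T_eq) simp
  ultimately show ?thesis
    unfolding J_eq abs_mult abs_of_pos[OF \<delta>_pos] by linarith
qed

text \<open>The sum is the integral of the path frozen at the left end of each cell, so the
  difference becomes one integral per cell.\<close>

private lemma I_minus_J:
  assumes "\<omega> \<in> space M"
  shows "I \<omega> - J \<omega> = (\<Sum>m<n. \<integral>u. h (X (real m * \<delta> + u) \<omega>) - h (X (real m * \<delta>) \<omega>)
    \<partial>restrict_space lborel {0<..<\<delta>})"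
proof -
  interpret finite_measure "restrict_space lborel {0<..<\<delta>}"
    by (rule finite_measure_restrict_lborel[where a=0 and b=\<delta>]) auto
  have "set_integrable lborel {0..real n * \<delta>} (\<lambda>t. h (X t \<omega>))"
    using set_integrable_path[OF assms, of 0 "{0..T}" T]
    by (simp add: set_integrable_def integrable_restrict_space T_eq)
  then have "I \<omega> = (\<Sum>m<n. LINT u:{0<..<\<delta>}|lborel. h (X (real m * \<delta> + u) \<omega>))"
    using set_integral_cells[of \<delta> n] \<delta>_pos by (simp add: integral_functional_def T_eq)
  also have "\<dots> = (\<Sum>m<n. \<integral>u. h (X (real m * \<delta> + u) \<omega>) \<partial>restrict_space lborel {0<..<\<delta>})"
    by (simp add: set_integral_restrict_space)
  moreover have "J \<omega> = (\<Sum>m<n. \<integral>u. h (X (real m * \<delta>) \<omega>) \<partial>restrict_space lborel {0<..<\<delta>})"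
    using \<delta>_pos by (simp add: J_eq sum_distrib_left measure_restrict_space space_restrict_space)
  moreover have "integrable (restrict_space lborel {0<..<\<delta>}) (\<lambda>u. h (X (real m * \<delta> + u) \<omega>))" for m
    using \<delta>_pos assms by (intro set_integrable_path[where b=\<delta>]) auto
  ultimately show ?thesis
    by (simp add: sum_subtractf)
qed

text \<open>Summing over the cells separately for each fixed time gives a bound independent of where
  that time lies: each entry of \<open>ts\<close> costs \<open>6 * ln n\<close>, and so does the
  pair of end times, whence the factor \<open>length ts + 1\<close>.\<close>

lemma base_estimate:
  assumes ts: "\<And>t. t \<in> set ts \<Longrightarrow> 0 \<le> t \<and> t < T"
  shows "\<bar>\<integral>\<omega>. path_prod h ts \<omega> * (I \<omega> - J \<omega>) * f (X T \<omega>) \<partial>P x\<bar>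
    \<le> C * H ^ (length ts + 1) * K * \<delta> * (6 * ln (real n)) * (real (length ts) + 1)"
proof -
  let ?\<kappa> = "restrict_space lborel {0<..<\<delta>}"
  let ?A = "C * H ^ (length ts + 1) * K"
  let ?L = "-1 # int n # map (\<lambda>t. \<lfloor>t / \<delta>\<rfloor>) ts"
  interpret \<kappa>: finite_measure ?\<kappa>
    by (rule finite_measure_restrict_lborel[where a=0 and b=\<delta>]) auto
  have A: "0 \<le> ?A" using C_nonneg H_nonneg K_nonneg by simp
  define \<psi> where "\<psi> m u \<omega> = path_prod h ts \<omega> * (h (X (real m * \<delta> + u) \<omega>) - h (X (real m * \<delta>) \<omega>)) * f (X T \<omega>)"
    for m u \<omega>
  have \<psi>_bound: "\<bar>\<psi> m u \<omega>\<bar> \<le> H ^ length ts * (H + H) * K" for m u \<omega>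
    unfolding abs_mult \<psi>_def
    by (intro mult_mono abs_prod_list_le h f order_trans[OF abs_triangle_ineq4] add_mono)
      (use H_nonneg K_nonneg in auto)
  have snd: "(\<lambda>z. Z (snd z)) \<in> borel_measurable (?\<kappa> \<Otimes>\<^sub>M M)" if "Z \<in> borel_measurable M" for Z :: "'w \<Rightarrow> real"
    by (rule measurable_compose[OF measurable_snd that])
  have \<psi>_meas: "case_prod (\<psi> m) \<in> borel_measurable (?\<kappa> \<Otimes>\<^sub>M M)" for m
  proof -
    have "{0<..<\<delta>} \<subseteq> {0..}" by auto
    then have "(\<lambda>z. h (X (real m * \<delta> + fst z) (snd z))) \<in> borel_measurable (?\<kappa> \<Otimes>\<^sub>M M)"
      using measurable_path_restrict[OF h(1), of "{0<..<\<delta>}" "real m * \<delta>"] \<delta>_pos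
      by (simp add: case_prod_beta')
    then show ?thesis unfolding \<psi>_def case_prod_beta' using ts T \<delta>_pos
      by (intro borel_measurable_times borel_measurable_diff snd measurable_path_prod measurable_comp_X h f) auto
  qed
  note Fubini = expectation_Fubini[OF \<kappa>.finite_measure_axioms \<psi>_meas \<psi>_bound]
  have pw: "path_prod h ts \<omega> * (I \<omega> - J \<omega>) * f (X T \<omega>) = (\<Sum>m<n. \<integral>u. \<psi> m u \<omega> \<partial>?\<kappa>)"
    if "\<omega> \<in> space M" for \<omega>
    unfolding I_minus_J[OF that] \<psi>_def by (simp add: sum_distrib_left sum_distrib_right)
  have int: "integrable (P x) (\<lambda>\<omega>. \<integral>u. \<psi> m u \<omega> \<partial>?\<kappa>)" for m
  proof (rule integrable_bounded[OF Fubini(3)])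
    show "\<bar>\<integral>u. \<psi> m u \<omega> \<partial>?\<kappa>\<bar> \<le> H ^ length ts * (H + H) * K * \<delta>" for \<omega>
    proof (cases "integrable ?\<kappa> (\<lambda>u. \<psi> m u \<omega>)")
      case True
      have "norm (\<integral>u. \<psi> m u \<omega> \<partial>?\<kappa>) \<le> (\<integral>u. H ^ length ts * (H + H) * K \<partial>?\<kappa>)"
        using \<psi>_bound by (intro Bochner_Integration.integral_norm_bound_integral True) auto
      then show ?thesis using \<delta>_pos by (simp add: measure_restrict_space space_restrict_space ac_simps)
    next
      case False
      then show ?thesis using H_nonneg K_nonneg \<delta>_pos by (simp add: not_integrable_integral_eq)
    qed
  qed
  have "(\<integral>\<omega>. path_prod h ts \<omega> * (I \<omega> - J \<omega>) * f (X T \<omega>) \<partial>P x)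
      = (\<integral>\<omega>. (\<Sum>m<n. \<integral>u. \<psi> m u \<omega> \<partial>?\<kappa>) \<partial>P x)"
    by (intro Bochner_Integration.integral_cong refl pw) (simp add: space_law)
  also have "\<dots> = (\<Sum>m<n. \<integral>u. (\<integral>\<omega>. \<psi> m u \<omega> \<partial>P x) \<partial>?\<kappa>)"
    using int by (simp add: Fubini(1))
  also have "\<bar>\<dots>\<bar> \<le> (\<Sum>m<n. \<bar>\<integral>u. (\<integral>\<omega>. \<psi> m u \<omega> \<partial>P x) \<partial>?\<kappa>\<bar>)"
    by (rule sum_abs)
  also have "\<dots> \<le> (\<Sum>m<n. ?A * (\<delta> * sum_list (map (\<lambda>c. cell_mean (c - int m)) ?L)))"
  proof (rule sum_mono)
    fix m assume m: "m \<in> {..<n}"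
    have weight_int: "integrable ?\<kappa> (\<lambda>u. sum_list (map (\<lambda>c. cell_weight \<delta> (c - int m) u) cs))"
      "(\<integral>u. sum_list (map (\<lambda>c. cell_weight \<delta> (c - int m) u) cs) \<partial>?\<kappa>)
        = \<delta> * sum_list (map (\<lambda>c. cell_mean (c - int m)) cs)" for cs
    proof (induction cs)
      case (Cons c cs)
      have "integrable ?\<kappa> (cell_weight \<delta> (c - int m))"
        using cell_weight_integral(1)[OF \<delta>_pos, of "c - int m"]
        by (simp add: set_integrable_def integrable_restrict_space)
      moreover have "(\<integral>u. cell_weight \<delta> (c - int m) u \<partial>?\<kappa>) = \<delta> * cell_mean (c - int m)"
        using cell_weight_integral(2)[OF \<delta>_pos, of "c - int m"]
        by (simp add: set_integral_restrict_space)
      ultimately show "integrable ?\<kappa> (\<lambda>u. sum_list (map (\<lambda>c. cell_weight \<delta> (c - int m) u) (c # cs)))"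
        "(\<integral>u. sum_list (map (\<lambda>c. cell_weight \<delta> (c - int m) u) (c # cs)) \<partial>?\<kappa>)
        = \<delta> * sum_list (map (\<lambda>c. cell_mean (c - int m)) (c # cs))"
        using Cons by (simp_all add: distrib_left)
    qed simp_all
    have "norm (\<integral>u. (\<integral>\<omega>. \<psi> m u \<omega> \<partial>P x) \<partial>?\<kappa>)
        \<le> (\<integral>u. ?A * sum_list (map (\<lambda>c. cell_weight \<delta> (c - int m) u) ?L) \<partial>?\<kappa>)"
    proof (rule Bochner_Integration.integral_norm_bound_integral[OF Fubini(2)])
      show "integrable ?\<kappa> (\<lambda>u. ?A * sum_list (map (\<lambda>c. cell_weight \<delta> (c - int m) u) ?L))"
        by (intro integrable_mult_right weight_int)
      fix u assume "u \<in> space ?\<kappa>"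
      then have u: "0 < u" "u < \<delta>" by (auto simp: space_restrict_space)
      show "norm (\<integral>\<omega>. \<psi> m u \<omega> \<partial>P x) \<le> ?A * sum_list (map (\<lambda>c. cell_weight \<delta> (c - int m) u) ?L)"
        unfolding \<psi>_def real_norm_def
        by (rule cell_estimate[OF modulus h f T _ \<delta> u ts]) (use m in auto)
    qed
    also have "\<dots> = ?A * (\<delta> * sum_list (map (\<lambda>c. cell_mean (c - int m)) ?L))"
      by (subst Bochner_Integration.integral_mult_right[OF weight_int(1)]) (simp only: weight_int(2))
    finally show "\<bar>\<integral>u. (\<integral>\<omega>. \<psi> m u \<omega> \<partial>P x) \<partial>?\<kappa>\<bar>
        \<le> ?A * (\<delta> * sum_list (map (\<lambda>c. cell_mean (c - int m)) ?L))" by simp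
  qed
  also have "\<dots> = ?A * \<delta> * (\<Sum>m<n. sum_list (map (\<lambda>c. cell_mean (c - int m)) ?L))"
    by (simp only: sum_distrib_left mult.assoc)
  also have "\<dots> \<le> ?A * \<delta> * ((6 * ln (real n)) * (real (length ts) + 1))"
  proof (rule mult_left_mono)
    have "(\<Sum>m<n. sum_list (map (\<lambda>t. cell_mean (\<lfloor>t / \<delta>\<rfloor> - int m)) ts)) \<le> 6 * ln (real n) * real (length ts)"
      using ts
    proof (induction ts)
      case (Cons t ts)
      have t: "0 \<le> t / \<delta>" "t / \<delta> < real n"
        using Cons.prems[of t] \<delta>_pos T_eq by (auto simp: pos_divide_less_eq)
      define c where "c = nat \<lfloor>t / \<delta>\<rfloor>"
      have c: "\<lfloor>t / \<delta>\<rfloor> = int c" "c < n" using t unfolding c_def by linarith+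
      have "(\<Sum>m<n. cell_mean (\<lfloor>t / \<delta>\<rfloor> - int m)) \<le> 6 * ln (real n)"
        unfolding c(1) by (rule sum_cell_mean_inner[OF n c(2)])
      with Cons show ?case by (simp add: sum.distrib distrib_left)
    qed simp
    then show "(\<Sum>m<n. sum_list (map (\<lambda>c. cell_mean (c - int m)) ?L))
        \<le> (6 * ln (real n)) * (real (length ts) + 1)"
      using sum_cell_mean_ends[OF n] by (simp add: sum.distrib distrib_left comp_def)
  qed (use A \<delta>_pos in auto)
  finally show ?thesis by (simp add: mult.assoc)
qed

private lemma measurable_fX: "(\<lambda>\<omega>. f (X T \<omega>)) \<in> borel_measurable M"
  using T by (intro measurable_comp_X f) simp

private lemma measurable_path_prod_times:
  assumes "\<And>t. t \<in> set ts \<Longrightarrow> 0 \<le> t \<and> t < T" "Y \<in> borel_measurable M"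
  shows "(\<lambda>\<omega>. path_prod h ts \<omega> * Y \<omega>) \<in> borel_measurable M"
  using assms by (intro borel_measurable_times measurable_path_prod h) auto

private lemma abs_path_prod_times_le:
  assumes "\<And>\<omega>. \<bar>Y \<omega>\<bar> \<le> B"
  shows "\<bar>path_prod h ts \<omega> * Y \<omega>\<bar> \<le> H ^ length ts * B"
  unfolding abs_mult using H_nonneg h(2)
  by (intro mult_mono abs_prod_list_le assms) auto

text \<open>\<open>J\<close> is a sum over grid times below \<open>T\<close> with total weight
  \<open>T\<close>. A bound that is uniform in one additional fixed time therefore absorbs a factor
  \<open>J\<close> at the price of a factor \<open>T\<close>.\<close>

lemma times_integral_sum_estimate:
  assumes Y: "Y \<in> borel_measurable M" "\<And>\<omega>. \<bar>Y \<omega>\<bar> \<le> B"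
    and D: "\<And>t. 0 \<le> t \<Longrightarrow> t < T \<Longrightarrow> \<bar>\<integral>\<omega>. path_prod h (t # ts) \<omega> * Y \<omega> \<partial>P x\<bar> \<le> D"
    and ts: "\<And>t. t \<in> set ts \<Longrightarrow> 0 \<le> t \<and> t < T"
  shows "\<bar>\<integral>\<omega>. path_prod h ts \<omega> * (J \<omega> * Y \<omega>) \<partial>P x\<bar> \<le> T * D"
proof -
  have lt: "real j * \<delta> < T" if "j < n" for j
    using that \<delta>_pos by (subst T_eq) simp
  have int: "integrable (P x) (\<lambda>\<omega>. path_prod h (real j * \<delta> # ts) \<omega> * Y \<omega>)" if "j < n" for j
  proof (rule integrable_bounded[OF _ abs_path_prod_times_le[OF Y(2)]])
    show "(\<lambda>\<omega>. path_prod h (real j * \<delta> # ts) \<omega> * Y \<omega>) \<in> borel_measurable M"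
      by (rule measurable_path_prod_times[OF _ Y(1)]) (use ts lt[OF that] \<delta>_pos in auto)
  qed
  have "(\<integral>\<omega>. path_prod h ts \<omega> * (J \<omega> * Y \<omega>) \<partial>P x)
      = (\<integral>\<omega>. \<delta> * (\<Sum>j<n. path_prod h (real j * \<delta> # ts) \<omega> * Y \<omega>) \<partial>P x)"
    by (simp add: J_eq sum_distrib_left sum_distrib_right ac_simps)
  also have "\<dots> = \<delta> * (\<Sum>j<n. \<integral>\<omega>. path_prod h (real j * \<delta> # ts) \<omega> * Y \<omega> \<partial>P x)"
    using int by simp
  also have "\<bar>\<dots>\<bar> \<le> \<delta> * (\<Sum>j<n. D)"
    unfolding abs_mult abs_of_pos[OF \<delta>_pos] using \<delta>_pos lt
    by (intro mult_left_mono order_trans[OF sum_abs sum_mono] D) auto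
  also have "\<dots> = T * D" by (subst T_eq) simp
  finally show ?thesis .
qed

text \<open>The same exchange for \<open>I\<close>, with Lebesgue measure on \<open>{0..<T}\<close>
  in place of the weighted grid.\<close>

lemma times_integral_functional_estimate:
  assumes Y: "Y \<in> borel_measurable M" "\<And>\<omega>. \<bar>Y \<omega>\<bar> \<le> B"
    and D: "\<And>t. 0 \<le> t \<Longrightarrow> t < T \<Longrightarrow> \<bar>\<integral>\<omega>. path_prod h (t # ts) \<omega> * Y \<omega> \<partial>P x\<bar> \<le> D"
    and ts: "\<And>t. t \<in> set ts \<Longrightarrow> 0 \<le> t \<and> t < T"
  shows "\<bar>\<integral>\<omega>. path_prod h ts \<omega> * (I \<omega> * Y \<omega>) \<partial>P x\<bar> \<le> T * D"
proof -
  let ?\<nu> = "restrict_space lborel {0..<T}"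
  interpret finite_measure ?\<nu>
    by (rule finite_measure_restrict_lborel[where a=0 and b=T]) auto
  have Ico_subset: "{0..<T} \<subseteq> {0..}" by auto
  have "(\<lambda>z. (path_prod h ts (snd z) * Y (snd z)) * h (X (fst z) (snd z))) \<in> borel_measurable (?\<nu> \<Otimes>\<^sub>M M)"
    using measurable_path_restrict[OF h(1) Ico_subset order_refl]
    by (intro borel_measurable_times[OF measurable_compose[OF measurable_snd measurable_path_prod_times[OF ts Y(1)]]])
      (simp_all add: case_prod_beta')
  then have meas: "case_prod (\<lambda>t \<omega>. path_prod h (t # ts) \<omega> * Y \<omega>) \<in> borel_measurable (?\<nu> \<Otimes>\<^sub>M M)"
    by (simp add: case_prod_beta' ac_simps)
  have bnd: "\<bar>path_prod h (t # ts) \<omega> * Y \<omega>\<bar> \<le> H ^ (length ts + 1) * B" for t \<omega>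
    using abs_path_prod_times_le[OF Y(2), where ts="t # ts" and \<omega>=\<omega>] by simp
  note Fubini = expectation_Fubini[OF finite_measure_axioms meas bnd]
  have "(\<integral>\<omega>. path_prod h ts \<omega> * (I \<omega> * Y \<omega>) \<partial>P x)
      = (\<integral>\<omega>. (\<integral>t. path_prod h (t # ts) \<omega> * Y \<omega> \<partial>?\<nu>) \<partial>P x)"
  proof (intro Bochner_Integration.integral_cong refl)
    fix \<omega>
    have "path_prod h ts \<omega> * (I \<omega> * Y \<omega>) = (path_prod h ts \<omega> * Y \<omega>) * (\<integral>t. h (X t \<omega>) \<partial>?\<nu>)"
      by (simp add: I_eq ac_simps)
    also have "\<dots> = (\<integral>t. (path_prod h ts \<omega> * Y \<omega>) * h (X t \<omega>) \<partial>?\<nu>)"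
      by simp
    finally show "path_prod h ts \<omega> * (I \<omega> * Y \<omega>) = (\<integral>t. path_prod h (t # ts) \<omega> * Y \<omega> \<partial>?\<nu>)"
      by (simp add: ac_simps)
  qed
  also have "\<dots> = (\<integral>t. (\<integral>\<omega>. path_prod h (t # ts) \<omega> * Y \<omega> \<partial>P x) \<partial>?\<nu>)"
    by (rule Fubini(1))
  also have "norm \<dots> \<le> (\<integral>t. D \<partial>?\<nu>)"
  proof (rule Bochner_Integration.integral_norm_bound_integral[OF Fubini(2)])
    show "norm (\<integral>\<omega>. path_prod h (t # ts) \<omega> * Y \<omega> \<partial>P x) \<le> D" if "t \<in> space ?\<nu>" for t
      unfolding real_norm_def by (rule D) (use that in \<open>auto simp: space_restrict_space\<close>)
  qed simp
  also have "\<dots> = T * D"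
    using T by (simp add: measure_restrict_space space_restrict_space)
  finally show ?thesis by simp
qed

text \<open>Each factor \<open>I\<close> or \<open>J\<close> that is peeled off becomes one more
  fixed time. The list grows as the exponent falls, so \<open>length ts + i + l\<close>, on which
  the bound depends, is preserved, and one factor \<open>T\<close> accumulates per step.\<close>

lemma mixed_power_estimate:
  assumes "\<And>t. t \<in> set ts \<Longrightarrow> 0 \<le> t \<and> t < T"
  shows "\<bar>\<integral>\<omega>. path_prod h ts \<omega> * (I \<omega> ^ i * (J \<omega> ^ l * ((I \<omega> - J \<omega>) * f (X T \<omega>)))) \<partial>P x\<bar>
    \<le> T ^ (i + l) * (C * H ^ (length ts + i + l + 1) * K * \<delta> * (6 * ln (real n)) * (real (length ts + i + l) + 1))"
proof -
  have Suc_length_l: "length (t # ts) + l = length ts + Suc l" for t :: real and ts l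
    by simp
  have Y: "(\<lambda>\<omega>. (I \<omega> - J \<omega>) * f (X T \<omega>)) \<in> borel_measurable M"
    by (intro borel_measurable_times borel_measurable_diff integral_functional_measurable integral_sum_measurable measurable_fX)
  have Y_le: "\<bar>(I \<omega> - J \<omega>) * f (X T \<omega>)\<bar> \<le> (T * H + T * H) * K" for \<omega>
    by (rule abs_mult_le[OF order_trans[OF abs_triangle_ineq4 add_mono[OF abs_integral_functional_le abs_integral_sum_le]] f(2)])
  have JY: "(\<lambda>\<omega>. J \<omega> ^ l * ((I \<omega> - J \<omega>) * f (X T \<omega>))) \<in> borel_measurable M" for l
    by (intro borel_measurable_times[OF _ Y] borel_measurable_power integral_sum_measurable)
  note JY_le = abs_mult_le[OF abs_power_le[OF abs_integral_sum_le] Y_le]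
  have IJY: "(\<lambda>\<omega>. I \<omega> ^ i * (J \<omega> ^ l * ((I \<omega> - J \<omega>) * f (X T \<omega>)))) \<in> borel_measurable M" for i l
    by (intro borel_measurable_times[OF _ JY] borel_measurable_power integral_functional_measurable)
  note IJY_le = abs_mult_le[OF abs_power_le[OF abs_integral_functional_le] JY_le]
  have J_powers: "\<bar>\<integral>\<omega>. path_prod h ts \<omega> * (J \<omega> ^ l * ((I \<omega> - J \<omega>) * f (X T \<omega>))) \<partial>P x\<bar>
    \<le> T ^ l * (C * H ^ (length ts + l + 1) * K * \<delta> * (6 * ln (real n)) * (real (length ts + l) + 1))"
    if "\<And>t. t \<in> set ts \<Longrightarrow> 0 \<le> t \<and> t < T" for ts l
    using that
  proof (induction l arbitrary: ts)
    case 0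
    then show ?case using base_estimate[of ts] by (simp add: mult.assoc)
  next
    case (Suc l)
    have "\<bar>\<integral>\<omega>. path_prod h ts \<omega> * (J \<omega> * (J \<omega> ^ l * ((I \<omega> - J \<omega>) * f (X T \<omega>)))) \<partial>P x\<bar>
      \<le> T * (T ^ l * (C * H ^ (length ts + Suc l + 1) * K * \<delta> * (6 * ln (real n)) * (real (length ts + Suc l) + 1)))"
    proof (rule times_integral_sum_estimate[OF JY JY_le _ Suc.prems])
      fix t assume "0 \<le> t" "t < T"
      then have "0 \<le> u \<and> u < T" if "u \<in> set (t # ts)" for u
        using Suc.prems[of u] that by auto
      note IH = Suc.IH[of "t # ts", OF this]
      show "\<bar>\<integral>\<omega>. path_prod h (t # ts) \<omega> * (J \<omega> ^ l * ((I \<omega> - J \<omega>) * f (X T \<omega>))) \<partial>P x\<bar>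
        \<le> T ^ l * (C * H ^ (length ts + Suc l + 1) * K * \<delta> * (6 * ln (real n)) * (real (length ts + Suc l) + 1))"
        using IH unfolding Suc_length_l by blast
    qed
    then show ?case by (simp add: mult.assoc)
  qed
  show ?thesis
    using assms
  proof (induction i arbitrary: ts)
    case 0
    then show ?case using J_powers[of ts l] by simp
  next
    case (Suc i)
    have "\<bar>\<integral>\<omega>. path_prod h ts \<omega> * (I \<omega> * (I \<omega> ^ i * (J \<omega> ^ l * ((I \<omega> - J \<omega>) * f (X T \<omega>))))) \<partial>P x\<bar>
      \<le> T * (T ^ (i + l) * (C * H ^ (length ts + Suc i + l + 1) * K * \<delta> * (6 * ln (real n)) * (real (length ts + Suc i + l) + 1)))"
    proof (rule times_integral_functional_estimate[OF IJY IJY_le _ Suc.prems])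
      fix t assume "0 \<le> t" "t < T"
      then have "0 \<le> u \<and> u < T" if "u \<in> set (t # ts)" for u
        using Suc.prems[of u] that by auto
      note IH = Suc.IH[of "t # ts", OF this]
      show "\<bar>\<integral>\<omega>. path_prod h (t # ts) \<omega> * (I \<omega> ^ i * (J \<omega> ^ l * ((I \<omega> - J \<omega>) * f (X T \<omega>)))) \<partial>P x\<bar>
        \<le> T ^ (i + l) * (C * H ^ (length ts + Suc i + l + 1) * K * \<delta> * (6 * ln (real n)) * (real (length ts + Suc i + l) + 1))"
        using IH unfolding Suc_length_l by blast
    qed
    then show ?case by (simp add: mult.assoc)
  qed
qed

lemma power_estimate:
  "\<bar>(\<integral>\<omega>. I \<omega> ^ k * f (X T \<omega>) \<partial>P x) - (\<integral>\<omega>. J \<omega> ^ k * f (X T \<omega>) \<partial>P x)\<bar>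
    \<le> 6 * (real k)\<^sup>2 * C * (T * H) ^ k * (ln (real n) / real n) * K"
proof (cases k)
  case (Suc k')
  have pow: "integrable (P x) (\<lambda>\<omega>. Y \<omega> ^ m * f (X T \<omega>))"
    if "Y \<in> borel_measurable M" "\<And>\<omega>. \<bar>Y \<omega>\<bar> \<le> T * H" for Y m
    by (rule integrable_bounded[OF borel_measurable_times[OF borel_measurable_power[OF that(1)] measurable_fX]
          abs_mult_le[OF abs_power_le[OF that(2)] f(2)]])
  have int: "integrable (P x) (\<lambda>\<omega>. I \<omega> ^ i * (J \<omega> ^ l * ((I \<omega> - J \<omega>) * f (X T \<omega>))))" for i l
  proof (rule integrable_bounded)
    show "(\<lambda>\<omega>. I \<omega> ^ i * (J \<omega> ^ l * ((I \<omega> - J \<omega>) * f (X T \<omega>)))) \<in> borel_measurable M"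
      by (intro borel_measurable_times borel_measurable_power borel_measurable_diff
          integral_functional_measurable integral_sum_measurable measurable_fX)
    show "\<bar>I \<omega> ^ i * (J \<omega> ^ l * ((I \<omega> - J \<omega>) * f (X T \<omega>)))\<bar>
        \<le> (T * H) ^ i * ((T * H) ^ l * ((T * H + T * H) * K))" for \<omega>
      by (rule abs_mult_le[OF abs_power_le[OF abs_integral_functional_le] abs_mult_le[OF abs_power_le[OF abs_integral_sum_le]
              abs_mult_le[OF order_trans[OF abs_triangle_ineq4 add_mono[OF abs_integral_functional_le abs_integral_sum_le]] f(2)]]])
  qed
  have telescope: "(a ^ k - b ^ k) * c = (\<Sum>p<k. a ^ p * (b ^ (k' - p) * ((a - b) * c)))" for a b c :: real
    unfolding Suc diff_power_eq_sum sum_distrib_left sum_distrib_right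
    by (intro sum.cong) (simp_all add: ac_simps)
  have "(\<integral>\<omega>. I \<omega> ^ k * f (X T \<omega>) \<partial>P x) - (\<integral>\<omega>. J \<omega> ^ k * f (X T \<omega>) \<partial>P x)
      = (\<integral>\<omega>. (I \<omega> ^ k - J \<omega> ^ k) * f (X T \<omega>) \<partial>P x)"
    using pow[OF integral_functional_measurable abs_integral_functional_le] pow[OF integral_sum_measurable abs_integral_sum_le] by (simp add: left_diff_distrib)
  also have "\<dots> = (\<integral>\<omega>. (\<Sum>p<k. I \<omega> ^ p * (J \<omega> ^ (k' - p) * ((I \<omega> - J \<omega>) * f (X T \<omega>)))) \<partial>P x)"
    by (simp only: telescope)
  also have "\<dots> = (\<Sum>p<k. \<integral>\<omega>. I \<omega> ^ p * (J \<omega> ^ (k' - p) * ((I \<omega> - J \<omega>) * f (X T \<omega>))) \<partial>P x)"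
    using int by simp
  finally have eq: "(\<integral>\<omega>. I \<omega> ^ k * f (X T \<omega>) \<partial>P x) - (\<integral>\<omega>. J \<omega> ^ k * f (X T \<omega>) \<partial>P x)
      = (\<Sum>p<k. \<integral>\<omega>. I \<omega> ^ p * (J \<omega> ^ (k' - p) * ((I \<omega> - J \<omega>) * f (X T \<omega>))) \<partial>P x)" .
  have "\<bar>\<Sum>p<k. \<integral>\<omega>. I \<omega> ^ p * (J \<omega> ^ (k' - p) * ((I \<omega> - J \<omega>) * f (X T \<omega>))) \<partial>P x\<bar>
      \<le> (\<Sum>p<k. T ^ k' * (C * H ^ k * K * \<delta> * (6 * ln (real n)) * real k))"
  proof (rule order_trans[OF sum_abs sum_mono])
    fix p assume "p \<in> {..<k}"
    then have p: "p + (k' - p) = k'" and k: "length ([] :: real list) + p + (k' - p) = k'" using Suc by simp_all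
    have "\<bar>\<integral>\<omega>. path_prod h [] \<omega> * (I \<omega> ^ p * (J \<omega> ^ (k' - p) * ((I \<omega> - J \<omega>) * f (X T \<omega>)))) \<partial>P x\<bar>
        \<le> T ^ k' * (C * H ^ (k' + 1) * K * \<delta> * (6 * ln (real n)) * (real k' + 1))"
      by (rule mixed_power_estimate[where ts="[]" and i=p and l="k' - p", unfolded p k]) simp
    moreover have "H ^ (k' + 1) = H ^ k" "real k' + 1 = real k" using Suc by simp_all
    ultimately show "\<bar>\<integral>\<omega>. I \<omega> ^ p * (J \<omega> ^ (k' - p) * ((I \<omega> - J \<omega>) * f (X T \<omega>))) \<partial>P x\<bar>
        \<le> T ^ k' * (C * H ^ k * K * \<delta> * (6 * ln (real n)) * real k)"
      by (simp only: list.map prod_list.Nil mult_1)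
  qed
  also have "\<dots> = 6 * (real k)\<^sup>2 * C * (T * H) ^ k * (ln (real n) / real n) * K"
  proof -
    \<comment> \<open>The \<open>k'\<close> peeled factors give \<open>T ^ k'\<close>; the missing
      factor \<open>T\<close> comes from the cell length, which also supplies the decay in
      \<open>n\<close>.\<close>
    have "T ^ k' * \<delta> = T ^ k / real n" by (simp add: Suc \<delta>)
    moreover have "(\<Sum>p<k. T ^ k' * (C * H ^ k * K * \<delta> * (6 * ln (real n)) * real k))
        = real k * ((T ^ k' * \<delta>) * C * H ^ k * K * (6 * ln (real n)) * real k)"
      by simp
    ultimately have "(\<Sum>p<k. T ^ k' * (C * H ^ k * K * \<delta> * (6 * ln (real n)) * real k))
        = real k * ((T ^ k / real n) * C * H ^ k * K * (6 * ln (real n)) * real k)"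
      by (simp only:)
    then show ?thesis by (simp add: power2_eq_square power_mult_distrib)
  qed
  finally show ?thesis unfolding eq .
qed simp

end

end

section \<open>The estimate for analytic functions\<close>

text \<open>Absolute convergence at the extreme value \<open>S\<close> dominates all terms uniformly
  in \<open>\<omega>\<close>, which justifies exchanging series and expectation.\<close>

lemma (in markov_process) expectation_power_series:
  fixes Y Z :: "'w \<Rightarrow> real" and a :: "nat \<Rightarrow> real"
  assumes Y: "Y \<in> borel_measurable M" "\<And>\<omega>. \<bar>Y \<omega>\<bar> \<le> S"
    and Z: "Z \<in> borel_measurable M" "\<And>\<omega>. \<bar>Z \<omega>\<bar> \<le> K"
    and a: "\<And>y. \<bar>y\<bar> \<le> S \<Longrightarrow> (\<lambda>m. a m * y ^ m) sums g y"
    and summable: "summable (\<lambda>m. \<bar>a m\<bar> * S ^ m)"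
  shows "(\<lambda>m. a m * (\<integral>\<omega>. Y \<omega> ^ m * Z \<omega> \<partial>P x)) sums (\<integral>\<omega>. g (Y \<omega>) * Z \<omega> \<partial>P x)"
proof -
  have term_le: "\<bar>a m * (Y \<omega> ^ m * Z \<omega>)\<bar> \<le> \<bar>a m\<bar> * (S ^ m * K)" for m \<omega>
    by (rule abs_mult_le[OF order_refl abs_mult_le[OF abs_power_le[OF Y(2)] Z(2)]])
  have meas: "(\<lambda>\<omega>. a m * (Y \<omega> ^ m * Z \<omega>)) \<in> borel_measurable M" for m
    using Y(1) Z(1) by (intro borel_measurable_times borel_measurable_power) auto
  have int: "integrable (P x) (\<lambda>\<omega>. a m * (Y \<omega> ^ m * Z \<omega>))" for m
    by (rule integrable_bounded[OF meas term_le])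
  have sumK: "summable (\<lambda>m. \<bar>a m\<bar> * (S ^ m * K))"
    using summable_mult2[OF summable, of K] by (simp add: mult.assoc)
  have "(\<lambda>m. \<integral>\<omega>. a m * (Y \<omega> ^ m * Z \<omega>) \<partial>P x) sums (\<integral>\<omega>. (\<Sum>m. a m * (Y \<omega> ^ m * Z \<omega>)) \<partial>P x)"
  proof (rule sums_integral[OF int])
    show "AE \<omega> in P x. summable (\<lambda>m. norm (a m * (Y \<omega> ^ m * Z \<omega>)))"
      by (intro AE_I2 summable_comparison_test'[OF sumK, of 0]) (use term_le in simp)
    show "summable (\<lambda>m. \<integral>\<omega>. norm (a m * (Y \<omega> ^ m * Z \<omega>)) \<partial>P x)"
    proof (rule summable_comparison_test'[OF sumK, of 0])
      fix m
      show "norm (\<integral>\<omega>. norm (a m * (Y \<omega> ^ m * Z \<omega>)) \<partial>P x) \<le> \<bar>a m\<bar> * (S ^ m * K)"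
        unfolding real_norm_def
        by (rule abs_expectation_le[OF borel_measurable_abs[OF meas]]) (use term_le in simp)
    qed
  qed
  moreover have "(\<Sum>m. a m * (Y \<omega> ^ m * Z \<omega>)) = g (Y \<omega>) * Z \<omega>" for \<omega>
    using sums_mult2[OF a[OF Y(2)], of \<omega> "Z \<omega>"] by (simp add: sums_iff mult.assoc)
  ultimately show ?thesis by simp
qed

theorem corollary1:
  fixes M :: "'w measure"
    and X :: "real \<Rightarrow> 'w \<Rightarrow> real ^ 'd"
    and P :: "real ^ 'd \<Rightarrow> 'w measure"
    and x :: "real ^ 'd"
    and f h :: "real ^ 'd \<Rightarrow> real"
    and g :: "real \<Rightarrow> real"
    and U :: "real set"
    and T C D R :: real
    and n :: nat
  assumes "markov_process M X P"
    and "0 < T"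
    and "condition_X X P T C"
    and "open U" and "0 \<in> U" and "real_analytic_on g U"
    and "0 < D" and "0 < R"
    and "\<And>m::nat. 1 \<le> m \<Longrightarrow> \<bar>(deriv ^^ m) g 0 / fact m\<bar> \<le> D * (1 / R) ^ m"
    and "f \<in> borel_measurable borel" and "bounded (range f)"
    and "h \<in> borel_measurable borel" and "bounded (range h)"
    and "T * sup_norm h < R"
    and "{- (T * sup_norm h) .. T * sup_norm h} \<subseteq> U"
    and "2 \<le> n"
  shows "\<bar>(\<integral>\<omega>. g (integral_functional X T h \<omega>) * f (X T \<omega>) \<partial>(P x))
            - (\<integral>\<omega>. g (integral_sum X T n h \<omega>) * f (X T \<omega>) \<partial>(P x))\<bar>
          \<le> 6 * D * C * (T * sup_norm h / R) * (1 + T * sup_norm h / R)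
              * (1 / (1 - T * sup_norm h / R) ^ 3)
              * (ln (real n) / real n) * sup_norm f"
proof -
  interpret markov_process M X P by fact
  define H K S z where "H = sup_norm h" and "K = sup_norm f" and "S = T * H" and "z = S / R"
  define a where "a m = (deriv ^^ m) g 0 / fact m" for m
  define E where "E Y m = (\<integral>\<omega>. Y \<omega> ^ m * f (X T \<omega>) \<partial>P x)" for Y :: "'w \<Rightarrow> real" and m
  let ?I = "integral_functional X T h" and ?J = "integral_sum X T n h"
  have sup: "\<bar>k y\<bar> \<le> sup_norm k" if "bounded (range k)" for k :: "real ^ 'd \<Rightarrow> real" and y
    using that unfolding sup_norm_def
    by (intro cSUP_upper) (auto simp: bounded_real bdd_above_def)
  have h: "h \<in> borel_measurable borel" "\<And>y. \<bar>h y\<bar> \<le> H" and f: "f \<in> borel_measurable borel" "\<And>y. \<bar>f y\<bar> \<le> K"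
    using assms sup by (auto simp: H_def K_def)
  have C: "1 \<le> C" using assms(3) by (simp add: condition_X_def)
  have modulus: "log_modulus C T"
    unfolding log_modulus_def transition_op_def
    using condition_X_tv_estimate[OF assms(1,3)] C by blast
  \<comment> \<open>In the order of the assumptions of the moment estimates; \<open>refl\<close>
    fixes the cell length as \<open>T / real n\<close>.\<close>
  note setting = modulus assms(2,16) refl h f
  have H0: "0 \<le> H" using order_trans[OF abs_ge_zero h(2)] .
  have S: "0 \<le> S" "S < R" using H0 assms by (simp_all add: S_def H_def)
  have z: "0 \<le> z" "z < 1" using S assms(8) by (simp_all add: z_def)
  have coeff: "\<bar>a m\<bar> * S ^ m \<le> D * z ^ m" if "1 \<le> m" for m
    using mult_right_mono[OF assms(9)[OF that], of "S ^ m"] S(1)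
    by (simp add: a_def z_def power_divide)
  have summable: "summable (\<lambda>m. \<bar>a m\<bar> * S ^ m)"
  proof (rule summable_comparison_test'[of "\<lambda>m. D * z ^ m" 1])
    show "summable (\<lambda>m. D * z ^ m)" using z by (intro summable_mult summable_geometric) simp
    show "norm (\<bar>a m\<bar> * S ^ m) \<le> D * z ^ m" if "1 \<le> m" for m
      using coeff[OF that] S(1) by simp
  qed
  have series: "(\<lambda>m. a m * y ^ m) sums g y" if "\<bar>y\<bar> \<le> S" for y
    unfolding a_def using real_analytic_power_series[OF assms(6) _ S assms(9) that] assms(15)
    by (simp add: S_def H_def)
  have fX: "(\<lambda>\<omega>. f (X T \<omega>)) \<in> borel_measurable M"
    using assms(2) by (intro measurable_comp_X f) simp
  note sums = expectation_power_series[OF _ _ fX f(2) series summable]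
  have "(\<lambda>m. a m * E ?I m) sums (\<integral>\<omega>. g (?I \<omega>) * f (X T \<omega>) \<partial>P x)"
    unfolding E_def S_def
    by (rule sums[unfolded S_def, OF integral_functional_measurable[OF setting] abs_integral_functional_le[OF setting]])
  moreover have "(\<lambda>m. a m * E ?J m) sums (\<integral>\<omega>. g (?J \<omega>) * f (X T \<omega>) \<partial>P x)"
    unfolding E_def S_def
    by (rule sums[unfolded S_def, OF integral_sum_measurable[OF setting] abs_integral_sum_le[OF setting]])
  ultimately have diff: "(\<lambda>m. a m * E ?I m - a m * E ?J m) sums
      ((\<integral>\<omega>. g (?I \<omega>) * f (X T \<omega>) \<partial>P x) - (\<integral>\<omega>. g (?J \<omega>) * f (X T \<omega>) \<partial>P x))"
    by (rule sums_diff)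
  define B where "B = 6 * C * (ln (real n) / real n) * K"
  have B: "0 \<le> B"
    using C order_trans[OF abs_ge_zero f(2)] assms(16) by (simp add: B_def)
  have bound: "norm (a m * E ?I m - a m * E ?J m) \<le> D * B * ((real m)\<^sup>2 * z ^ m)" for m
  \<comment> \<open>The coefficient of order \<open>0\<close> is not controlled by \<open>D\<close>,
    but the two moments of order \<open>0\<close> coincide and the term cancels.\<close>
  proof (cases "m = 0")
    case False
    have "\<bar>E ?I m - E ?J m\<bar> \<le> 6 * (real m)\<^sup>2 * C * S ^ m * (ln (real n) / real n) * K"
      unfolding E_def S_def by (rule power_estimate[OF setting])
    then have "\<bar>a m\<bar> * \<bar>E ?I m - E ?J m\<bar> \<le> \<bar>a m\<bar> * ((real m)\<^sup>2 * B * S ^ m)"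
      by (intro mult_left_mono) (simp_all add: B_def ac_simps)
    also have "\<dots> = ((real m)\<^sup>2 * B) * (\<bar>a m\<bar> * S ^ m)" by simp
    also have "\<dots> \<le> ((real m)\<^sup>2 * B) * (D * z ^ m)"
      using coeff[of m] False B by (intro mult_left_mono) auto
    finally show ?thesis by (simp add: abs_mult right_diff_distrib[symmetric] ac_simps)
  qed (simp add: E_def)
  have total: "(\<lambda>m. D * B * ((real m)\<^sup>2 * z ^ m)) sums (D * B * (z * (1 + z) / (1 - z) ^ 3))"
    using z by (intro sums_mult sums_square_times_power) simp
  have "norm (\<Sum>m. a m * E ?I m - a m * E ?J m) \<le> (\<Sum>m. D * B * ((real m)\<^sup>2 * z ^ m))"
    by (rule norm_suminf_le[OF bound sums_summable[OF total]])
  then show ?thesis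
    unfolding sums_unique[OF diff, symmetric] sums_unique[OF total, symmetric]
    by (simp add: B_def z_def S_def H_def K_def ac_simps)
qed

end
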